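(* Let $\varphi:\mathbb{R}^n\to(-\infty,\infty]$ be proper and lower semicontinuous, and let $\varphi$ be $C^2$-strictly $u$-decomposable at $\bar x$ for $\bar\lambda\in\mathcal Q$ with decomposition pair $(\varphi_d,F)$, $\varphi_d=\sigma_{\mathcal Q}$. Then $$\mathrm{d}^2_s\varphi(\bar x\,|\,DF(\bar x)^\top\bar\lambda)(h)=\langle\bar\lambda,D^2F(\bar x)[h,h]\rangle+\iota_{\mathrm{aff}(DF(\bar x)^{-1}N_{\mathcal Q}(\bar\lambda))}(h)\qquad\forall\,h\in\mathbb{R}^n.$$
   Context: $\partial$ is the limiting subdifferential, $\sigma_{\mathcal Q}$ the support function, $\iota_C$ the indicator function, $T_{\mathcal Q}$, $N_{\mathcal Q}$ the tangent and normal cones of a convex set, $\mathrm{aff}$ the affine hull, $\mathrm{lin}(K)=K\cap(-K)$; for a matrix $A$ and a set $C$, $A^{-1}C:=\{h:Ah\in C\}$. Set convergence is in the Painlevé–Kuratowski sense. Decomposability: $\varphi$ is $C^\ell$-decomposable at $\bar x\in\mathrm{dom}(\varphi)$ with decomposition pair $(\varphi_d,F)$ if there is an open neighborhood $U$ of $\bar x$ with $\varphi(x)=\varphi(\bar x)+\varphi_d(F(x))$ for all $x\in U$, where (i) $F:U\to\mathbb{R}^m$ is $\ell$-times continuously differentiable and $F(\bar x)=0$; (ii) $\varphi_d=\sigma_{\mathcal Q}:\mathbb{R}^m\to(-\infty,\infty]$ for some nonempty closed convex set $\mathcal Q\subseteq\mathbb{R}^m$; (iii) $0\in\mathrm{int}\{DF(\bar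 x)\mathbb{R}^n-\mathrm{dom}(\varphi_d)\}$. It is $C^\ell$-strictly decomposable at $\bar x$ for $\bar\lambda\in\mathcal Q$ if in addition $DF(\bar x)\mathbb{R}^n-N_{\mathcal Q}(\bar\lambda)=\mathbb{R}^m$. Uniform second-order tangent path ($\mathcal{UTP}$-)property: a closed convex set $\mathcal Q$ has it at $\bar\lambda\in\mathcal Q$ if there are constants $\delta>0$, $M>0$ and a neighborhood $V$ of $\bar\lambda$ such that for all $\lambda\in\mathcal Q\cap V$: (i) one can select a linear subspace $S(\lambda)\subseteq\mathrm{lin}(T_{\mathcal Q}(\lambda))$ such that $S(\lambda)\to\mathrm{lin}(T_{\mathcal Q}(\bar\lambda))$ as $\lambda\to\bar\lambda$; (ii) for all $v\in S(\lambda)$ with $\|v\|=1$ there is a path $\xi:[0,\delta]\to\mathcal Q$ with $\xi(t)=\lambda+tv+\frac12t^2r(t)$ and $\|r(t)\|\le M$ for all $t\in[0,\delta]$. $\varphi$ is $C^2$-strictly $u$-decomposable at $\bar x$ for $\bar\lambda$ if it is $C^2$-strictly decomposable at $\bar x$ for $\bar\lambda$ and $\mathcal Q$ has the $\mathcal{UTP}$-property at $\bar\lambda$. Strict second subderivative: with $\Delta_t^2\varphi(x|v)(h):=\frac{\varphi(x+th)-\varphi(x)-t\langle v,h\rangle}{\frac12t^2}$, for $\bar v\in\partial\varphi(\bar x)$, $$\mathrm{d}^2_s\varphi(\bar x|\bar v)(h):=\liminf_{t\downarrow0,\ \tilde h\to h,\ \varphi(x)\to\varphi(\bar x),\ \mathrm{gph}(\partial\varphi)\ni(x,v)\to(\bar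 x,\bar v)}\Delta_t^2\varphi(x|v)(\tilde h).$$ *)

theory Defs
  imports "HOL-Analysis.Analysis"
begin

section \<open>Extended-real-valued functions\<close>

definition proper :: "('a \<Rightarrow> ereal) \<Rightarrow> bool" where
  "proper f \<longleftrightarrow> (\<forall>x. f x \<noteq> -\<infinity>) \<and> (\<exists>x. f x \<noteq> \<infinity>)"

definition lower_semicontinuous :: "('a::topological_space \<Rightarrow> ereal) \<Rightarrow> bool" where
  "lower_semicontinuous f \<longleftrightarrow> (\<forall>x. f x \<le> Liminf (nhds x) f)"

definition eff_dom :: "('a \<Rightarrow> ereal) \<Rightarrow> 'a set" where
  "eff_dom f = {x. f x < \<infinity>}"

text \<open>The indicator function of convex analysis, unlike the 0/1-valued \<^const>\<open>indicator\<close>.\<close>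

definition cvx_indicator :: "'a set \<Rightarrow> 'a \<Rightarrow> ereal" where
  "cvx_indicator C x = (if x \<in> C then 0 else \<infinity>)"

definition support_fun :: "'a::real_inner set \<Rightarrow> 'a \<Rightarrow> ereal" where
  "support_fun Q y = (SUP l\<in>Q. ereal (l \<bullet> y))"


section \<open>Painleve-Kuratowski set convergence; tangent and normal cones\<close>

definition outer_limit :: "'i filter \<Rightarrow> ('i \<Rightarrow> 'a::topological_space set) \<Rightarrow> 'a set" where
  "outer_limit G C = {x. \<forall>W. open W \<and> x \<in> W \<longrightarrow> (\<exists>\<^sub>F i in G. C i \<inter> W \<noteq> {})}"

definition inner_limit :: "'i filter \<Rightarrow> ('i \<Rightarrow> 'a::topological_space set) \<Rightarrow> 'a set" where
  "inner_limit G C = {x. \<forall>W. open W \<and> x \<in> W \<longrightarrow> (\<forall>\<^sub>F i in G. C i \<inter> W \<noteq> {})}"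

definition PK_converges :: "('i \<Rightarrow> 'a::topological_space set) \<Rightarrow> 'a set \<Rightarrow> 'i filter \<Rightarrow> bool" where
  "PK_converges C D G \<longleftrightarrow> outer_limit G C = D \<and> inner_limit G C = D"

text \<open>The tangent cone is the outer limit of \<open>(Q - l) / t\<close> as \<open>t \<down> 0\<close>.\<close>

definition tangent_cone :: "'a::real_normed_vector set \<Rightarrow> 'a \<Rightarrow> 'a set" where
  "tangent_cone Q l = outer_limit (at_right (0::real)) (\<lambda>t. {w. l + t *\<^sub>R w \<in> Q})"

definition normal_cone :: "'a::real_inner set \<Rightarrow> 'a \<Rightarrow> 'a set" where
  "normal_cone Q l = (if l \<in> Q then {z. \<forall>m\<in>Q. z \<bullet> (m - l) \<le> 0} else {})"

definition lineality :: "'a::ab_group_add set \<Rightarrow> 'a set" where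
  "lineality K = K \<inter> uminus ` K"


section \<open>Limiting subdifferential and strict second subderivative\<close>

definition regular_subdiff :: "('a::real_inner \<Rightarrow> ereal) \<Rightarrow> 'a \<Rightarrow> 'a set" where
  "regular_subdiff f x =
     {v. \<bar>f x\<bar> \<noteq> \<infinity> \<and>
         0 \<le> Liminf (at x) (\<lambda>y. (f y - f x - ereal (v \<bullet> (y - x))) / ereal (norm (y - x)))}"

definition subdiff :: "('a::real_inner \<Rightarrow> ereal) \<Rightarrow> 'a \<Rightarrow> 'a set" where
  "subdiff f x =
     {v. \<bar>f x\<bar> \<noteq> \<infinity> \<and>
         (\<exists>(X :: nat \<Rightarrow> 'a) (V :: nat \<Rightarrow> 'a).
            X \<longlonglongrightarrow> x \<and> (\<lambda>k. f (X k)) \<longlonglongrightarrow> f x \<and>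
            (\<forall>k. V k \<in> regular_subdiff f (X k)) \<and> V \<longlonglongrightarrow> v)}"

definition second_diff_quot ::
  "('a::real_inner \<Rightarrow> ereal) \<Rightarrow> real \<Rightarrow> 'a \<Rightarrow> 'a \<Rightarrow> 'a \<Rightarrow> ereal" where
  "second_diff_quot f t x v h =
     (f (x + t *\<^sub>R h) - f x - ereal (t * (v \<bullet> h))) / ereal (t\<^sup>2 / 2)"

text \<open>The filter of pairs \<open>(x, v)\<close> in the graph of the subdifferential that converge to
  \<open>(xb, vb)\<close> with \<open>f x\<close> converging to \<open>f xb\<close>.  The point \<open>(xb, vb)\<close> itself is admitted.\<close>

definition attentive_graph_filter ::
  "('a::real_inner \<Rightarrow> ereal) \<Rightarrow> 'a \<Rightarrow> 'a \<Rightarrow> ('a \<times> 'a) filter" where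
  "attentive_graph_filter f xb vb =
     inf (nhds (xb, vb))
       (inf (principal {(x, v). v \<in> subdiff f x})
            (filtercomap (\<lambda>(x, v). f x) (nhds (f xb))))"

text \<open>As usual, this is meant for \<open>vb \<in> subdiff f xb\<close>.\<close>

definition strict_second_subderiv ::
  "('a::real_inner \<Rightarrow> ereal) \<Rightarrow> 'a \<Rightarrow> 'a \<Rightarrow> 'a \<Rightarrow> ereal" where
  "strict_second_subderiv f xb vb h =
     Liminf (at_right (0::real) \<times>\<^sub>F nhds h \<times>\<^sub>F attentive_graph_filter f xb vb)
       (\<lambda>(t, h', x, v). second_diff_quot f t x v h')"


section \<open>Smooth maps\<close>

text \<open>On an open subset of a finite-dimensional space, \<open>k + 1\<close> times continuously differentiable
  means differentiable with \<open>k\<close> times continuously differentiable derivative; in finite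
  dimensions the latter can be tested pointwise in the direction \<open>v\<close>, which keeps the recursion
  within one type.\<close>

primrec Ck_on ::
  "nat \<Rightarrow> ('a::euclidean_space \<Rightarrow> 'b::euclidean_space) \<Rightarrow> 'a set \<Rightarrow> bool" where
  "Ck_on 0 F U \<longleftrightarrow> continuous_on U F"
| "Ck_on (Suc k) F U \<longleftrightarrow>
     (\<forall>x\<in>U. F differentiable (at x)) \<and>
     (\<forall>v. Ck_on k (\<lambda>x. frechet_derivative F (at x) v) U)"

abbreviation D1 :: "('a::euclidean_space \<Rightarrow> 'b::euclidean_space) \<Rightarrow> 'a \<Rightarrow> 'a \<Rightarrow> 'b" where
  "D1 F x \<equiv> frechet_derivative F (at x)"

definition D2 :: "('a::euclidean_space \<Rightarrow> 'b::euclidean_space) \<Rightarrow> 'a \<Rightarrow> 'a \<Rightarrow> 'a \<Rightarrow> 'b" where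
  "D2 F x u w = frechet_derivative (\<lambda>y. D1 F y w) (at x) u"


section \<open>Decomposability\<close>

text \<open>The decomposition pair is \<open>(support_fun Q, F)\<close>; only the values of \<open>F\<close> on the
  neighborhood \<open>U\<close> matter.\<close>

definition decomposable_at ::
  "nat \<Rightarrow> ('a::euclidean_space \<Rightarrow> ereal) \<Rightarrow> 'a \<Rightarrow> 'b::euclidean_space set \<Rightarrow> ('a \<Rightarrow> 'b) \<Rightarrow> bool" where
  "decomposable_at k f xb Q F \<longleftrightarrow>
     xb \<in> eff_dom f \<and>
     Q \<noteq> {} \<and> closed Q \<and> convex Q \<and>
     (\<exists>U. open U \<and> xb \<in> U \<and> Ck_on k F U \<and>
          (\<forall>x\<in>U. f x = f xb + support_fun Q (F x))) \<and>
     F xb = 0 \<and>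
     0 \<in> interior {D1 F xb u - y | u y. y \<in> eff_dom (support_fun Q)}"

definition strictly_decomposable_at ::
  "nat \<Rightarrow> ('a::euclidean_space \<Rightarrow> ereal) \<Rightarrow> 'a \<Rightarrow> 'b::euclidean_space set \<Rightarrow> ('a \<Rightarrow> 'b) \<Rightarrow> 'b \<Rightarrow> bool"
  where
  "strictly_decomposable_at k f xb Q F lb \<longleftrightarrow>
     decomposable_at k f xb Q F \<and> lb \<in> Q \<and>
     {D1 F xb u - z | u z. z \<in> normal_cone Q lb} = UNIV"

text \<open>The limit \<open>l \<rightarrow> lb\<close> runs over \<open>Q\<close> and, as is the convention in variational analysis,
  does not exclude \<open>l = lb\<close>.\<close>

definition UTP_at :: "'b::euclidean_space set \<Rightarrow> 'b \<Rightarrow> bool" where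
  "UTP_at Q lb \<longleftrightarrow>
     lb \<in> Q \<and>
     (\<exists>\<delta>>0. \<exists>M>0. \<exists>V. open V \<and> lb \<in> V \<and>
       (\<exists>S :: 'b \<Rightarrow> 'b set.
          (\<forall>l\<in>Q \<inter> V. subspace (S l) \<and> S l \<subseteq> lineality (tangent_cone Q l)) \<and>
          PK_converges S (lineality (tangent_cone Q lb)) (inf (nhds lb) (principal Q)) \<and>
          (\<forall>l\<in>Q \<inter> V. \<forall>v\<in>S l. norm v = 1 \<longrightarrow>
             (\<exists>(\<xi> :: real \<Rightarrow> 'b) (r :: real \<Rightarrow> 'b).
                continuous_on {0..\<delta>} \<xi> \<and>
                (\<forall>t\<in>{0..\<delta>}. \<xi> t \<in> Q \<and>
                   \<xi> t = l + t *\<^sub>R v + (t\<^sup>2 / 2) *\<^sub>R r t \<and> norm (r t) \<le> M)))))"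

definition C2_strictly_u_decomposable_at ::
  "('a::euclidean_space \<Rightarrow> ereal) \<Rightarrow> 'a \<Rightarrow> 'b::euclidean_space set \<Rightarrow> ('a \<Rightarrow> 'b) \<Rightarrow> 'b \<Rightarrow> bool" where
  "C2_strictly_u_decomposable_at f xb Q F lb \<longleftrightarrow>
     strictly_decomposable_at 2 f xb Q F lb \<and> UTP_at Q lb"

end

theory Submission
  imports Defs
begin

text \<open>Write \<open>A\<close> for the derivative of \<open>F\<close> at \<open>xb\<close> and \<open>N\<close> for the normal cone of \<open>Q\<close> at \<open>lb\<close>.
  The strict constraint qualification gives a bound \<open>|l - lb| \<le> c |A\<^sup>T (l - lb)|\<close> for \<open>l \<in> Q\<close>,
  stable under small perturbations of \<open>A\<close>.  Hence every subgradient \<open>v\<close> at \<open>x\<close> near \<open>xb\<close> comes from a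
  multiplier \<open>l \<in> Q\<close> that is exposed by \<open>F x\<close> (replace the support function by its Moreau envelopes
  and pass to the limit), and \<open>l\<close> tends to \<open>lb\<close>.  Testing the support function
  at \<open>x + t h\<close> with \<open>l\<close> itself and Taylor expanding bounds the quotients from below by the curvature
  term.  If \<open>h\<close> lies outside the affine hull, some \<open>w\<close> in the lineality space of the tangent cone has
  \<open>w \<bullet> A h > 0\<close>; testing instead with the point at parameter \<open>C t\<close> of the tangent path in a direction
  close to \<open>w\<close> adds \<open>2 C (w \<bullet> A h)\<close> with arbitrary \<open>C\<close>.  If \<open>h = h1 - h2\<close> with \<open>A h1, A h2 \<in> N\<close>, there are
  points \<open>x = xb + t h2 + o(t)\<close> and \<open>y = xb + t h1 + o(t)\<close> that \<open>F\<close> maps into \<open>N\<close>; there the function is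
  \<open>lb \<bullet> F\<close> up to a constant, and the quotients attain the curvature term.\<close>

section \<open>Tangent and normal cones\<close>

lemma zero_mem_normal_cone: "l \<in> Q \<Longrightarrow> 0 \<in> normal_cone Q l"
  by (simp add: normal_cone_def)

lemma normal_cone_add:
  "x \<in> normal_cone Q l \<Longrightarrow> y \<in> normal_cone Q l \<Longrightarrow> x + y \<in> normal_cone Q l"
  by (force simp: normal_cone_def inner_add_left split: if_splits)

lemma normal_cone_scale:
  "x \<in> normal_cone Q l \<Longrightarrow> 0 \<le> c \<Longrightarrow> c *\<^sub>R x \<in> normal_cone Q l"
  by (force simp: normal_cone_def mult_nonneg_nonpos split: if_splits)

text \<open>The differences already form a subspace: a negative multiple of \<open>a - b\<close> is
  a positive multiple of \<open>b - a\<close>, so the two summands just swap roles.\<close>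

lemma span_convex_cone:
  assumes zero: "0 \<in> K"
    and add: "\<And>x y. x \<in> K \<Longrightarrow> y \<in> K \<Longrightarrow> x + y \<in> K"
    and scale: "\<And>x c. x \<in> K \<Longrightarrow> 0 \<le> c \<Longrightarrow> c *\<^sub>R x \<in> K"
  shows "span K = {a - b | a b. a \<in> K \<and> b \<in> K}" (is "_ = ?D")
proof (rule span_unique)
  show "K \<subseteq> ?D"
    using zero by force
  show "subspace ?D"
  proof (rule subspaceI)
    show "0 \<in> ?D"
      using zero by force
    fix x y assume "x \<in> ?D" "y \<in> ?D"
    then obtain a b a' b' where "x = a - b" "y = a' - b'" "a \<in> K" "b \<in> K" "a' \<in> K" "b' \<in> K"
      by blast
    then have "x + y = (a + a') - (b + b')" "a + a' \<in> K" "b + b' \<in> K"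
      using add by auto
    then show "x + y \<in> ?D"
      by blast
  next
    fix c :: real and x assume "x \<in> ?D"
    then obtain a b where ab: "x = a - b" "a \<in> K" "b \<in> K"
      by blast
    show "c *\<^sub>R x \<in> ?D"
    proof (cases "0 \<le> c")
      case True
      then have "c *\<^sub>R x = c *\<^sub>R a - c *\<^sub>R b" "c *\<^sub>R a \<in> K" "c *\<^sub>R b \<in> K"
        using ab scale by (auto simp: algebra_simps)
      then show ?thesis by blast
    next
      case False
      then have "c *\<^sub>R x = (-c) *\<^sub>R b - (-c) *\<^sub>R a" "(-c) *\<^sub>R a \<in> K" "(-c) *\<^sub>R b \<in> K"
        using ab scale[of a "-c"] scale[of b "-c"] by (auto simp: algebra_simps)
      then show ?thesis by blast
    qed
  qed
  show "?D \<subseteq> T" if "K \<subseteq> T" "subspace T" for T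
    using that by (auto intro: subspace_diff)
qed

text \<open>The two forms serve the two cases of the formula. The span turns \<open>h\<close>
  outside the hull into \<open>A h\<close> outside \<open>span N\<close>, where a separating
  direction exists; the differences split \<open>h\<close> inside the hull into
  \<open>h1 - h2\<close>.\<close>

lemma affine_hull_vimage_normal_cone:
  assumes "linear A" "l \<in> Q"
    and cq: "{A u - z | u z. z \<in> normal_cone Q l} = UNIV"
  shows "affine hull (A -` normal_cone Q l) = A -` span (normal_cone Q l)" (is "?lhs = ?rhs")
    and "affine hull (A -` normal_cone Q l) =
      {a - b | a b. A a \<in> normal_cone Q l \<and> A b \<in> normal_cone Q l}"
proof -
  let ?N = "normal_cone Q l"
  have spanN: "span ?N = {a - b | a b. a \<in> ?N \<and> b \<in> ?N}"
    using zero_mem_normal_cone[OF \<open>l \<in> Q\<close>] normal_cone_add normal_cone_scale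
    by (rule span_convex_cone)
  have spanK: "span (A -` ?N) = {a - b | a b. a \<in> A -` ?N \<and> b \<in> A -` ?N}"
    by (rule span_convex_cone)
      (auto simp: linear_0 linear_add linear_scale zero_mem_normal_cone normal_cone_add
        normal_cone_scale assms)
  have aff: "affine hull (A -` ?N) = span (A -` ?N)"
    by (rule affine_hull_span_0, rule hull_inc)
      (simp add: linear_0 zero_mem_normal_cone assms)
  show "affine hull (A -` ?N) = {a - b | a b. A a \<in> ?N \<and> A b \<in> ?N}"
    unfolding aff spanK by simp
  have "x \<in> span (A -` ?N)" if x: "A x \<in> span ?N" for x
  proof -
    from x spanN obtain a b where ab: "A x = a - b" "a \<in> ?N" "b \<in> ?N"
      by blast
    \<comment> \<open>The constraint qualification pulls \<open>b\<close> back through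
      \<open>A\<close> up to an element of the cone. Shifting by the resulting \<open>u\<close> puts
      both parts of \<open>x = (x + u) - u\<close> into the preimage.\<close>
    have "b \<in> {A u - z | u z. z \<in> ?N}"
      by (simp add: cq)
    then obtain u z where "b = A u - z" and z: "z \<in> ?N"
      by blast
    then have "A u = b + z" "A (x + u) = a + z"
      using ab by (auto simp: linear_add \<open>linear A\<close>)
    then have "u \<in> A -` ?N" "x + u \<in> A -` ?N"
      using ab z by (auto intro: normal_cone_add)
    moreover have "x = (x + u) - u"
      by simp
    ultimately show ?thesis
      unfolding spanK by blast
  qed
  moreover have "A x \<in> span ?N" if "x \<in> span (A -` ?N)" for x
    using that unfolding spanK spanN by (fastforce simp: linear_diff \<open>linear A\<close>)
  ultimately show "?lhs = ?rhs"
    unfolding aff by auto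
qed

section \<open>Normal vectors as the points where a given \<open>l\<close> attains the support
  function\<close>

lemma support_fun_ge: "l \<in> Q \<Longrightarrow> ereal (l \<bullet> y) \<le> support_fun Q y"
  unfolding support_fun_def by (rule SUP_upper)

lemma support_fun_normal_cone:
  assumes "z \<in> normal_cone Q l"
  shows "support_fun Q z = ereal (l \<bullet> z)"
proof (rule antisym)
  have "l \<in> Q"
    using assms by (auto simp: normal_cone_def split: if_splits)
  then show "ereal (l \<bullet> z) \<le> support_fun Q z"
    by (rule support_fun_ge)
  show "support_fun Q z \<le> ereal (l \<bullet> z)"
    unfolding support_fun_def
    using assms by (intro SUP_least)
      (auto simp: normal_cone_def inner_diff_right inner_commute split: if_splits)
qed

text \<open>An inequality suffices because the opposite one holds for every
  \<open>l \<in> Q\<close>. In this form the condition survives passage to the limit in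
  \<open>subdiff_multiplier\<close>.\<close>

lemma normal_cone_support_fun:
  assumes "l \<in> Q" "support_fun Q z \<le> ereal (l \<bullet> z)"
  shows "z \<in> normal_cone Q l"
proof -
  have "m \<bullet> z \<le> l \<bullet> z" if "m \<in> Q" for m
    using order_trans[OF support_fun_ge[OF that] assms(2)] by simp
  then show ?thesis
    using assms(1) by (auto simp: normal_cone_def inner_diff_right inner_commute)
qed

section \<open>Polarity between tangent and normal cones\<close>

lemma tangent_normal_nonpos:
  assumes "w \<in> tangent_cone Q l" "z \<in> normal_cone Q l"
  shows "z \<bullet> w \<le> 0"
proof (rule ccontr)
  assume "\<not> z \<bullet> w \<le> 0"
  \<comment> \<open>The outer limit only yields points of \<open>Q\<close> in directions near
    \<open>w\<close>. The open half-space serves as the neighborhood, so that such a direction still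
    has positive product with \<open>z\<close>.\<close>
  then have "w \<in> {w. 0 < z \<bullet> w}"
    by simp
  moreover have "open {w. 0 < z \<bullet> w}"
    by (rule open_halfspace_gt)
  ultimately have "\<exists>\<^sub>F t in at_right 0. {w. l + t *\<^sub>R w \<in> Q} \<inter> {w. 0 < z \<bullet> w} \<noteq> {}"
    using assms(1) unfolding tangent_cone_def outer_limit_def by blast
  moreover have "\<forall>\<^sub>F t in at_right (0::real). 0 < t"
    by (rule eventually_at_right_less)
  ultimately obtain t where "{w. l + t *\<^sub>R w \<in> Q} \<inter> {w. 0 < z \<bullet> w} \<noteq> {}" "0 < t"
    using frequently_ex[OF frequently_eventually_frequently] by blast
  then obtain w' where "l + t *\<^sub>R w' \<in> Q" "0 < z \<bullet> w'" "0 < t"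
    by blast
  moreover have "z \<bullet> (l + t *\<^sub>R w' - l) \<le> 0"
    using assms(2) \<open>l + t *\<^sub>R w' \<in> Q\<close> by (auto simp only: normal_cone_def split: if_splits)
  ultimately show False
    by (simp add: mult_le_0_iff)
qed

text \<open>Both \<open>w\<close> and \<open>- w\<close> obey the polar inequality. Consequently the
  first-order term of a tangent path at \<open>l\<close> is invisible to a vector normal at
  \<open>l\<close>.\<close>

lemma lineality_tangent_normal_orthogonal:
  assumes "w \<in> lineality (tangent_cone Q l)" "z \<in> normal_cone Q l"
  shows "w \<bullet> z = 0"
proof -
  have "w \<in> tangent_cone Q l" "- w \<in> tangent_cone Q l"
    using assms(1) by (auto simp: lineality_def)
  then show ?thesis
    using tangent_normal_nonpos[OF _ assms(2), of w] tangent_normal_nonpos[OF _ assms(2), of "- w"]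
    by (simp add: inner_commute)
qed

text \<open>By convexity a direction \<open>s *\<^sub>R (q - l)\<close> stays feasible for all small
  \<open>t\<close>. One such direction in the neighborhood \<open>W\<close> therefore serves the
  whole filter.\<close>

lemma mem_tangent_cone_closure:
  assumes "convex Q" "l \<in> Q"
    and w: "w \<in> closure (\<Union>s\<in>{0..}. (\<lambda>q. s *\<^sub>R (q - l)) ` Q)"
  shows "w \<in> tangent_cone Q l"
  unfolding tangent_cone_def outer_limit_def
proof (intro CollectI allI impI)
  fix W assume "open W \<and> w \<in> W"
  then have "W \<inter> (\<Union>s\<in>{0..}. (\<lambda>q. s *\<^sub>R (q - l)) ` Q) \<noteq> {}"
    using w open_Int_closure_eq_empty by blast
  then obtain s q where s: "s \<ge> 0" "q \<in> Q" "s *\<^sub>R (q - l) \<in> W"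
    by blast
  have "\<forall>\<^sub>F t in at_right 0. {w. l + t *\<^sub>R w \<in> Q} \<inter> W \<noteq> {}"
    unfolding eventually_at_right_field
  proof (intro exI[of _ "1 / (s + 1)"] conjI allI impI)
    show "0 < 1 / (s + 1)"
      using s by simp
    fix t :: real assume t: "0 < t" "t < 1 / (s + 1)"
    then have "t * s \<le> 1"
      using s by (simp add: field_simps)
    then have "(1 - t * s) *\<^sub>R l + (t * s) *\<^sub>R q \<in> Q"
      using s t assms by (intro convexD) auto
    then have "l + t *\<^sub>R (s *\<^sub>R (q - l)) \<in> Q"
      by (simp add: algebra_simps)
    then show "{w. l + t *\<^sub>R w \<in> Q} \<inter> W \<noteq> {}"
      using s by blast
  qed
  then show "\<exists>\<^sub>F t in at_right 0. {w. l + t *\<^sub>R w \<in> Q} \<inter> W \<noteq> {}"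
    by (intro eventually_frequently) auto
qed

text \<open>The bipolar theorem, by separation: a hyperplane that separates \<open>w\<close> from
  the closed cone generated by \<open>Q - l\<close> has a normal \<open>a\<close> with
  \<open>- a\<close> in the normal cone and \<open>- a \<bullet> w > 0\<close>.\<close>

lemma polar_normal_cone_subset_tangent_cone:
  fixes Q :: "'b::euclidean_space set"
  assumes "convex Q" "l \<in> Q" and w: "\<And>z. z \<in> normal_cone Q l \<Longrightarrow> z \<bullet> w \<le> 0"
  shows "w \<in> tangent_cone Q l"
proof (rule ccontr)
  let ?C = "\<Union>s\<in>{0..}. (\<lambda>q. s *\<^sub>R (q - l)) ` Q"
  assume "w \<notin> tangent_cone Q l"
  then have notin: "w \<notin> closure ?C"
    using mem_tangent_cone_closure assms by blast
  have "?C = conic hull ((\<lambda>q. q - l) ` Q)"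
    by (auto simp: conic_hull_explicit)
  moreover have "convex (conic hull ((\<lambda>q. q - l) ` Q))"
    using \<open>convex Q\<close> by (intro convex_conic_hull convex_translation_subtract)
  ultimately have "convex (closure ?C)"
    by (simp add: convex_closure)
  then obtain a b where ab: "a \<bullet> w < b" "\<And>x. x \<in> closure ?C \<Longrightarrow> b < a \<bullet> x"
    using separating_hyperplane_closed_point[of "closure ?C" w] notin by auto
  have C: "b < s * (a \<bullet> (q - l))" if "0 \<le> s" "q \<in> Q" for s q
    using ab(2)[of "s *\<^sub>R (q - l)"] that closure_subset[of ?C] by auto
  have "b < 0"
    using C[of 0 l] assms by simp
  have "0 \<le> a \<bullet> (q - l)" if "q \<in> Q" for q
  proof (rule ccontr)
    assume neg: "\<not> 0 \<le> a \<bullet> (q - l)"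
    \<comment> \<open>At this multiple of \<open>q - l\<close> the functional equals
      \<open>b\<close>, although it exceeds \<open>b\<close> on the entire cone.\<close>
    then have "0 \<le> b / (a \<bullet> (q - l))"
      using \<open>b < 0\<close> by (simp add: divide_nonpos_neg)
    from C[OF this that] show False
      using neg by simp
  qed
  then have "- a \<in> normal_cone Q l"
    using assms by (auto simp: normal_cone_def)
  from w[OF this] show False
    using ab \<open>b < 0\<close> by simp
qed

text \<open>Take the component of \<open>y\<close> orthogonal to the span. All its multiples, of
  either sign, are polar to the normal cone, hence tangent; normalised, it pairs with
  \<open>y\<close> to the norm of that component.\<close>

lemma exists_lineality_not_in_span_normal_cone:
  fixes Q :: "'b::euclidean_space set"
  assumes "convex Q" "l \<in> Q" "y \<notin> span (normal_cone Q l)"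
  obtains w where "w \<in> lineality (tangent_cone Q l)" "norm w = 1" "0 < w \<bullet> y"
proof -
  obtain p z where p: "p \<in> span (normal_cone Q l)"
    and z: "\<And>n. n \<in> span (normal_cone Q l) \<Longrightarrow> orthogonal z n" and y: "y = p + z"
    using orthogonal_subspace_decomp_exists[of "normal_cone Q l" y] by blast
  have "z \<noteq> 0"
    using assms p y by auto
  have *: "c *\<^sub>R z \<in> tangent_cone Q l" for c
    using assms(1,2)
    by (rule polar_normal_cone_subset_tangent_cone)
      (use z span_base in \<open>force simp: orthogonal_def inner_commute\<close>)
  then have "sgn z \<in> lineality (tangent_cone Q l)"
    unfolding lineality_def sgn_div_norm
    using *[of "inverse (norm z)"] *[of "- inverse (norm z)"]
    by (auto intro: image_eqI[where x = "(- inverse (norm z)) *\<^sub>R z"])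
  moreover have "sgn z \<bullet> y = norm z"
    using z[OF p] \<open>z \<noteq> 0\<close>
    by (simp add: y sgn_div_norm orthogonal_def inner_add_right dot_square_norm power2_eq_square)
  ultimately show ?thesis
    using that \<open>z \<noteq> 0\<close> by (metis norm_sgn zero_less_norm_iff)
qed

section \<open>Taylor expansion of twice continuously differentiable maps\<close>

lemma Ck_on_2D:
  assumes "Ck_on 2 F U" "x \<in> U"
  shows "F differentiable (at x)"
    and "(\<lambda>y. D1 F y w) differentiable (at x)"
    and "continuous_on U (\<lambda>y. D2 F y u w)"
  using assms unfolding D2_def by (auto simp: numeral_2_eq_2)

lemma D1_has_derivative:
  assumes "Ck_on 2 F U" "x \<in> U"
  shows "(F has_derivative D1 F x) (at x)"
  using Ck_on_2D(1)[OF assms] frechet_derivative_works by blast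

lemma D1_linear: "Ck_on 2 F U \<Longrightarrow> x \<in> U \<Longrightarrow> linear (D1 F x)"
  by (rule linear_frechet_derivative, rule Ck_on_2D)

lemma D2_has_derivative:
  assumes "Ck_on 2 F U" "x \<in> U"
  shows "((\<lambda>y. D1 F y w) has_derivative (\<lambda>u. D2 F x u w)) (at x)"
  using Ck_on_2D(2)[OF assms] frechet_derivative_works unfolding D2_def by blast

text \<open>\<open>Ck_on\<close> provides continuity only for each fixed direction. Expanding in
  coordinates upgrades this to joint convergence when the directions vary as well.\<close>

lemma linear_tendsto_Basis:
  fixes L :: "'i \<Rightarrow> 'a::euclidean_space \<Rightarrow> 'b::real_normed_vector"
  assumes "\<forall>\<^sub>F i in G. linear (L i)" "linear L'"
    and conv: "\<And>e. e \<in> Basis \<Longrightarrow> ((\<lambda>i. L i e) \<longlongrightarrow> L' e) G" and H: "(H \<longlongrightarrow> h) G"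
  shows "((\<lambda>i. L i (H i)) \<longlongrightarrow> L' h) G"
proof -
  have expand: "f v = (\<Sum>e\<in>Basis. (v \<bullet> e) *\<^sub>R f e)" if "linear f" for f :: "'a \<Rightarrow> 'b" and v
  proof -
    have "f v = f (\<Sum>e\<in>Basis. (v \<bullet> e) *\<^sub>R e)"
      by (simp add: euclidean_representation)
    also have "\<dots> = (\<Sum>e\<in>Basis. (v \<bullet> e) *\<^sub>R f e)"
      using that by (simp add: linear_sum linear_scale)
    finally show ?thesis .
  qed
  have "((\<lambda>i. \<Sum>e\<in>Basis. (H i \<bullet> e) *\<^sub>R L i e) \<longlongrightarrow> (\<Sum>e\<in>Basis. (h \<bullet> e) *\<^sub>R L' e)) G"
    by (intro tendsto_intros H conv)
  moreover have "\<forall>\<^sub>F i in G. (\<Sum>e\<in>Basis. (H i \<bullet> e) *\<^sub>R L i e) = L i (H i)"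
    using assms(1) by eventually_elim (simp flip: expand)
  ultimately show ?thesis
    unfolding expand[OF assms(2), of h] by (rule Lim_transform_eventually)
qed

section \<open>Taylor expansion and limits of derivatives along filters\<close>

context
  fixes F :: "'a::euclidean_space \<Rightarrow> 'b::euclidean_space" and U
  assumes U: "open U" and F: "Ck_on 2 F U"
begin

lemma D2_linear: "x \<in> U \<Longrightarrow> linear (\<lambda>u. D2 F x u w)"
  using D2_has_derivative[OF F] has_derivative_linear by blast

text \<open>\<open>D2\<close> is a derivative in its first direction only. Linearity in the second
  follows from linearity of \<open>D1 F y\<close> on the open set \<open>U\<close> and uniqueness of
  derivatives.\<close>

lemma D2_linear_right:
  assumes "x \<in> U"
  shows "linear (\<lambda>w. D2 F x u w)"
proof (rule linearI)
  fix v w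
  have "((\<lambda>y. D1 F y v + D1 F y w) has_derivative (\<lambda>u. D2 F x u v + D2 F x u w)) (at x)"
    by (intro derivative_intros D2_has_derivative[OF F] assms)
  then have "((\<lambda>y. D1 F y (v + w)) has_derivative (\<lambda>u. D2 F x u v + D2 F x u w)) (at x)"
    by (rule has_derivative_transform_within_open[OF _ U assms])
      (simp add: linear_add D1_linear[OF F])
  then show "D2 F x u (v + w) = D2 F x u v + D2 F x u w"
    using has_derivative_unique[OF _ D2_has_derivative[OF F assms]] by metis
next
  fix c :: real and w
  have "((\<lambda>y. c *\<^sub>R D1 F y w) has_derivative (\<lambda>u. c *\<^sub>R D2 F x u w)) (at x)"
    by (intro derivative_intros D2_has_derivative[OF F] assms)
  then have "((\<lambda>y. D1 F y (c *\<^sub>R w)) has_derivative (\<lambda>u. c *\<^sub>R D2 F x u w)) (at x)"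
    by (rule has_derivative_transform_within_open[OF _ U assms])
      (simp add: linear_scale D1_linear[OF F])
  then show "D2 F x u (c *\<^sub>R w) = c *\<^sub>R D2 F x u w"
    using has_derivative_unique[OF _ D2_has_derivative[OF F assms]] by metis
qed

text \<open>The exact intermediate-point form holds for scalar functions, so \<open>F\<close> is
  tested against a fixed \<open>e\<close>, on which the intermediate point may depend.\<close>

lemma second_order_Taylor:
  assumes "0 < t" and seg: "\<And>s. 0 \<le> s \<Longrightarrow> s \<le> t \<Longrightarrow> x + s *\<^sub>R h \<in> U"
  shows "\<exists>s. 0 < s \<and> s < t \<and>
    e \<bullet> ((2 / t\<^sup>2) *\<^sub>R (F (x + t *\<^sub>R h) - F x - t *\<^sub>R D1 F x h)) = e \<bullet> D2 F (x + s *\<^sub>R h) h h"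
proof -
  \<comment> \<open>For \<open>m \<le> 2\<close> this is the derivative of order \<open>m\<close> of
    \<open>e \<bullet> F (x + s *\<^sub>R h)\<close> with respect to \<open>s\<close>.\<close>
  define diff :: "nat \<Rightarrow> real \<Rightarrow> real" where "diff = (\<lambda>m s. if m = 0 then e \<bullet> F (x + s *\<^sub>R h)
    else if m = 1 then e \<bullet> D1 F (x + s *\<^sub>R h) h else e \<bullet> D2 F (x + s *\<^sub>R h) h h)"
  have "DERIV (diff m) s :> diff (Suc m) s" if "m < 2" "0 \<le> s" "s \<le> t" for m :: nat and s
  proof -
    have line: "((\<lambda>s. x + s *\<^sub>R h) has_derivative (\<lambda>s. s *\<^sub>R h)) (at s)"
      by (auto intro!: derivative_eq_intros)
    have sU: "x + s *\<^sub>R h \<in> U"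
      using seg that by simp
    consider "m = 0" | "m = 1"
      using \<open>m < 2\<close> by linarith
    then show ?thesis
    proof cases
      case 1
      have "((\<lambda>s. e \<bullet> F (x + s *\<^sub>R h)) has_derivative (\<lambda>r. e \<bullet> D1 F (x + s *\<^sub>R h) (r *\<^sub>R h))) (at s)"
        by (intro has_derivative_inner_right has_derivative_compose[OF line] D1_has_derivative[OF F sU])
      then show ?thesis
        by (simp add: 1 diff_def has_field_derivative_def linear_scale[OF D1_linear[OF F sU]]
            mult.commute[of _ "e \<bullet> _"])
    next
      case 2
      have "((\<lambda>s. e \<bullet> D1 F (x + s *\<^sub>R h) h) has_derivative
          (\<lambda>r. e \<bullet> D2 F (x + s *\<^sub>R h) (r *\<^sub>R h) h)) (at s)"
        by (intro has_derivative_inner_right has_derivative_compose[OF line] D2_has_derivative[OF F sU])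
      then show ?thesis
        by (simp add: 2 diff_def has_field_derivative_def linear_scale[OF D2_linear[OF sU]]
            mult.commute[of _ "e \<bullet> _"])
    qed
  qed
  then have "\<exists>s>0. s < t \<and> diff 0 t = (\<Sum>m<2. diff m 0 / fact m * t ^ m) + diff 2 s / fact 2 * t ^ 2"
    using \<open>0 < t\<close> by (intro Maclaurin) auto
  then obtain s where s: "0 < s" "s < t"
    and "diff 0 t = (\<Sum>m<2. diff m 0 / fact m * t ^ m) + diff 2 s / fact 2 * t ^ 2"
    by blast
  then have "e \<bullet> F (x + t *\<^sub>R h) - e \<bullet> F x - t * (e \<bullet> D1 F x h) = (t\<^sup>2 / 2) * (e \<bullet> D2 F (x + s *\<^sub>R h) h h)"
    by (simp add: diff_def numeral_2_eq_2)
  then have "e \<bullet> ((2 / t\<^sup>2) *\<^sub>R (F (x + t *\<^sub>R h) - F x - t *\<^sub>R D1 F x h)) = e \<bullet> D2 F (x + s *\<^sub>R h) h h"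
    using \<open>0 < t\<close> by (simp add: inner_diff_right divide_eq_eq algebra_simps)
  with s show ?thesis
    by blast
qed

context
  fixes xb
  assumes xb: "xb \<in> U"
begin

lemma eventually_in_U: "(X \<longlongrightarrow> xb) G \<Longrightarrow> \<forall>\<^sub>F i in G. X i \<in> U"
  using U xb by (rule topological_tendstoD[rotated])

lemma F_tendsto:
  assumes "(X \<longlongrightarrow> xb) G"
  shows "((\<lambda>i. F (X i)) \<longlongrightarrow> F xb) G"
  using D1_has_derivative[OF F xb] assms
  by (intro isCont_tendsto_compose[of xb F]) (auto dest: has_derivative_continuous)

lemma D1_tendsto:
  assumes X: "(X \<longlongrightarrow> xb) G" and H: "(H \<longlongrightarrow> h) G"
  shows "((\<lambda>i. D1 F (X i) (H i)) \<longlongrightarrow> D1 F xb h) G"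
proof (rule linear_tendsto_Basis[OF _ _ _ H])
  show "\<forall>\<^sub>F i in G. linear (D1 F (X i))"
    using eventually_in_U[OF X] by eventually_elim (rule D1_linear[OF F])
  show "linear (D1 F xb)"
    using F xb by (rule D1_linear)
  show "((\<lambda>i. D1 F (X i) e) \<longlongrightarrow> D1 F xb e) G" for e
    using D2_has_derivative[OF F xb] X
    by (intro isCont_tendsto_compose[of xb "\<lambda>x. D1 F x e"]) (auto dest: has_derivative_continuous)
qed

lemma D2_tendsto:
  assumes X: "(X \<longlongrightarrow> xb) G" and H: "(H \<longlongrightarrow> h) G"
  shows "((\<lambda>i. D2 F (X i) (H i) (H i)) \<longlongrightarrow> D2 F xb h h) G"
proof (rule linear_tendsto_Basis[OF _ _ _ H, of "\<lambda>i u. D2 F (X i) u (H i)" "\<lambda>u. D2 F xb u h"])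
  show "\<forall>\<^sub>F i in G. linear (\<lambda>u. D2 F (X i) u (H i))"
    using eventually_in_U[OF X] by eventually_elim (rule D2_linear)
  show "linear (\<lambda>u. D2 F xb u h)"
    using xb by (intro D2_linear)
  fix e
  show "((\<lambda>i. D2 F (X i) e (H i)) \<longlongrightarrow> D2 F xb e h) G"
  proof (rule linear_tendsto_Basis[OF _ _ _ H])
    show "\<forall>\<^sub>F i in G. linear (D2 F (X i) e)"
      using eventually_in_U[OF X] by eventually_elim (rule D2_linear_right)
    show "linear (D2 F xb e)"
      using xb by (intro D2_linear_right)
    show "((\<lambda>i. D2 F (X i) e e') \<longlongrightarrow> D2 F xb e e') G" for e'
      using Ck_on_2D(3)[OF F xb, of e e'] U xb X
      by (intro isCont_tendsto_compose[of xb "\<lambda>x. D2 F x e e'"])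
        (auto simp: continuous_on_eq_continuous_at)
  qed
qed

lemma adjoint_D1_tendsto:
  assumes X: "(X \<longlongrightarrow> xb) G" and L: "(L \<longlongrightarrow> l) G"
  shows "((\<lambda>i. adjoint (D1 F (X i)) (L i)) \<longlongrightarrow> adjoint (D1 F xb) l) G"
  unfolding tendsto_componentwise_iff[of _ "adjoint (D1 F xb) l"]
proof
  fix e :: 'a assume "e \<in> Basis"
  have "((\<lambda>i. D1 F (X i) e \<bullet> L i) \<longlongrightarrow> D1 F xb e \<bullet> l) G"
    by (intro tendsto_intros D1_tendsto X L)
  moreover have "\<forall>\<^sub>F i in G. D1 F (X i) e \<bullet> L i = adjoint (D1 F (X i)) (L i) \<bullet> e"
    using eventually_in_U[OF X]
    by eventually_elim (simp add: adjoint_works[OF D1_linear[OF F]] inner_commute)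
  ultimately show "((\<lambda>i. adjoint (D1 F (X i)) (L i) \<bullet> e) \<longlongrightarrow> adjoint (D1 F xb) l \<bullet> e) G"
    by (simp add: Lim_transform_eventually adjoint_works[OF D1_linear[OF F xb]]
        inner_commute[of _ e])
qed

text \<open>Base points move along with the step size, as the strict subderivative demands.
  Componentwise, the intermediate points are squeezed to \<open>xb\<close>, and continuity of the
  second derivative concludes.\<close>

lemma Taylor_quotient_tendsto:
  assumes T: "(T \<longlongrightarrow> 0) G" "\<forall>\<^sub>F i in G. 0 < T i" and X: "(X \<longlongrightarrow> xb) G" and H: "(H \<longlongrightarrow> h) G"
  shows "((\<lambda>i. (2 / (T i)\<^sup>2) *\<^sub>R (F (X i + T i *\<^sub>R H i) - F (X i) - T i *\<^sub>R D1 F (X i) (H i)))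
    \<longlongrightarrow> D2 F xb h h) G"
  unfolding tendsto_componentwise_iff[of _ "D2 F xb h h"]
proof
  fix e :: 'b assume "e \<in> Basis"
  let ?q = "\<lambda>i. (2 / (T i)\<^sup>2) *\<^sub>R (F (X i + T i *\<^sub>R H i) - F (X i) - T i *\<^sub>R D1 F (X i) (H i))"
  \<comment> \<open>Choosing one such \<open>s\<close> for each \<open>i\<close> turns the
    intermediate points into a function along the filter.\<close>
  define P where "P i s \<longleftrightarrow> 0 < s \<and> s < T i \<and> e \<bullet> ?q i = e \<bullet> D2 F (X i + s *\<^sub>R H i) (H i) (H i)" for i s
  obtain r where r: "0 < r" "ball xb r \<subseteq> U"
    using U xb open_contains_ball by blast
  have "((\<lambda>i. norm (X i - xb) + T i * norm (H i)) \<longlongrightarrow> norm (xb - xb) + 0 * norm h) G"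
    by (intro tendsto_intros T X H)
  then have "\<forall>\<^sub>F i in G. norm (X i - xb) + T i * norm (H i) < r"
    using r by (intro order_tendstoD) auto
  with T(2) have ev: "\<forall>\<^sub>F i in G. P i (SOME s. P i s)"
  proof eventually_elim
    case (elim i)
    have "X i + s *\<^sub>R H i \<in> U" if "0 \<le> s" "s \<le> T i" for s
    proof -
      have "norm (X i + s *\<^sub>R H i - xb) \<le> norm (X i - xb) + norm (s *\<^sub>R H i)"
        using norm_triangle_ineq[of "X i - xb" "s *\<^sub>R H i"] by (simp add: algebra_simps)
      also have "\<dots> \<le> norm (X i - xb) + T i * norm (H i)"
        using that by (simp add: mult_right_mono)
      also have "\<dots> < r"
        by (rule elim)
      finally show ?thesis
        using r by (auto simp: dist_norm norm_minus_commute)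
    qed
    then have "\<exists>s. P i s"
      unfolding P_def using elim by (intro second_order_Taylor)
    then show ?case
      by (rule someI_ex)
  qed
  have S: "((\<lambda>i. SOME s. P i s) \<longlongrightarrow> 0) G"
    by (rule tendsto_sandwich[OF _ _ tendsto_const T(1)])
      (use ev in \<open>auto elim!: eventually_mono simp: P_def\<close>)
  have "((\<lambda>i. X i + (SOME s. P i s) *\<^sub>R H i) \<longlongrightarrow> xb + 0 *\<^sub>R h) G"
    by (intro tendsto_intros S X H)
  then have "((\<lambda>i. D2 F (X i + (SOME s. P i s) *\<^sub>R H i) (H i) (H i) \<bullet> e) \<longlongrightarrow> D2 F xb h h \<bullet> e) G"
    by (intro tendsto_inner D2_tendsto H tendsto_const) simp
  moreover have "\<forall>\<^sub>F i in G. D2 F (X i + (SOME s. P i s) *\<^sub>R H i) (H i) (H i) \<bullet> e = ?q i \<bullet> e"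
    using ev by eventually_elim (simp add: P_def inner_commute)
  ultimately show "((\<lambda>i. ?q i \<bullet> e) \<longlongrightarrow> D2 F xb h h \<bullet> e) G"
    by (rule Lim_transform_eventually)
qed

text \<open>The quotient is \<open>D1 F (X i) (H i)\<close> plus \<open>T i / 2\<close> times the
  Taylor quotient, which converges and so stays harmless.\<close>

lemma difference_quotient_tendsto:
  assumes T: "(T \<longlongrightarrow> 0) G" "\<forall>\<^sub>F i in G. 0 < T i" and X: "(X \<longlongrightarrow> xb) G" and H: "(H \<longlongrightarrow> h) G"
  shows "((\<lambda>i. (F (X i + T i *\<^sub>R H i) - F (X i)) /\<^sub>R T i) \<longlongrightarrow> D1 F xb h) G"
proof -
  let ?q = "\<lambda>i. (2 / (T i)\<^sup>2) *\<^sub>R (F (X i + T i *\<^sub>R H i) - F (X i) - T i *\<^sub>R D1 F (X i) (H i))"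
  have "((\<lambda>i. D1 F (X i) (H i) + (T i / 2) *\<^sub>R ?q i) \<longlongrightarrow> D1 F xb h + (0 / 2) *\<^sub>R D2 F xb h h) G"
    by (intro tendsto_add D1_tendsto X H tendsto_scaleR Taylor_quotient_tendsto T tendsto_divide
        tendsto_const) auto
  moreover have "\<forall>\<^sub>F i in G. D1 F (X i) (H i) + (T i / 2) *\<^sub>R ?q i = (F (X i + T i *\<^sub>R H i) - F (X i)) /\<^sub>R T i"
    using T(2) by eventually_elim (simp add: algebra_simps power2_eq_square divide_simps)
  ultimately show ?thesis
    by (simp add: Lim_transform_eventually)
qed

end

end

section \<open>Consequences of the strict constraint qualification\<close>

text \<open>Write \<open>y = A u - z\<close> with \<open>z\<close> normal at \<open>lb\<close>.
  Since \<open>z \<bullet> (l - lb) \<le> 0\<close>, the product \<open>(lb - l) \<bullet> y\<close>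
  is controlled by \<open>u\<close> and the adjoint alone; letting \<open>y\<close> run over plus
  and minus the basis vectors bounds every coordinate.\<close>

lemma strict_cq_estimate:
  fixes A :: "'a::euclidean_space \<Rightarrow> 'b::euclidean_space"
  assumes A: "linear A" and cq: "{A u - z | u z. z \<in> normal_cone Q lb} = UNIV"
  obtains c where "0 < c" "\<And>l. l \<in> Q \<Longrightarrow> norm (l - lb) \<le> c * norm (adjoint A (l - lb))"
proof -
  have "\<exists>u z. y = A u - z \<and> z \<in> normal_cone Q lb" for y
    using cq by blast
  then obtain u z where uz: "\<And>y. y = A (u y) - z y" "\<And>y. z y \<in> normal_cone Q lb"
    by metis
  define c where "c = 1 + (\<Sum>e\<in>Basis. norm (u e) + norm (u (- e)))"
  have "norm (l - lb) \<le> c * norm (adjoint A (l - lb))" if "l \<in> Q" for l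
  proof -
    have *: "(lb - l) \<bullet> y \<le> norm (u y) * norm (adjoint A (l - lb))" for y
    proof -
      have "z y \<bullet> (l - lb) \<le> 0"
        using uz(2)[of y] \<open>l \<in> Q\<close> by (auto simp: normal_cone_def split: if_splits)
      moreover have "y \<bullet> (l - lb) = A (u y) \<bullet> (l - lb) - z y \<bullet> (l - lb)"
        using uz(1)[of y] by (metis inner_diff_left)
      moreover have "A (u y) \<bullet> (l - lb) = u y \<bullet> adjoint A (l - lb)"
        by (simp add: adjoint_works[OF A])
      moreover have "\<bar>u y \<bullet> adjoint A (l - lb)\<bar> \<le> norm (u y) * norm (adjoint A (l - lb))"
        by (rule Cauchy_Schwarz_ineq2)
      ultimately show ?thesis
        by (simp add: algebra_simps inner_commute)
    qed
    have "norm (l - lb) \<le> (\<Sum>e\<in>Basis. \<bar>(l - lb) \<bullet> e\<bar>)"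
      by (rule norm_le_l1)
    also have "\<dots> \<le> (\<Sum>e\<in>Basis. (norm (u e) + norm (u (- e))) * norm (adjoint A (l - lb)))"
    proof (rule sum_mono)
      fix e :: 'b
      have "0 \<le> norm (u e) * norm (adjoint A (l - lb))" "0 \<le> norm (u (- e)) * norm (adjoint A (l - lb))"
        by simp_all
      then show "\<bar>(l - lb) \<bullet> e\<bar> \<le> (norm (u e) + norm (u (- e))) * norm (adjoint A (l - lb))"
        using *[of e] *[of "- e"] unfolding distrib_right inner_minus_right inner_diff_left
        by linarith
    qed
    also have "\<dots> \<le> c * norm (adjoint A (l - lb))"
      unfolding c_def by (simp add: distrib_right[of 1] flip: sum_distrib_right)
    finally show ?thesis .
  qed
  moreover have "0 < c"
    unfolding c_def by (intro add_pos_nonneg sum_nonneg) auto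
  ultimately show ?thesis
    using that by blast
qed

text \<open>Moving from \<open>xb\<close> to \<open>x\<close> changes the adjoint at
  \<open>l - lb\<close> by at most \<open>r x * norm (l - lb)\<close>. Once
  \<open>r x < 1 / (2 * c)\<close>, half of the left-hand side is absorbed and the constant
  doubles.\<close>

lemma multiplier_estimate:
  fixes F :: "'a::euclidean_space \<Rightarrow> 'b::euclidean_space"
  assumes U: "open U" and F: "Ck_on 2 F U" and xb: "xb \<in> U"
    and cq: "{D1 F xb u - z | u z. z \<in> normal_cone Q lb} = UNIV"
  obtains c where "0 < c"
    "\<forall>\<^sub>F x in nhds xb. \<forall>l\<in>Q. norm (l - lb) \<le> c * norm (adjoint (D1 F x) (l - lb))"
proof -
  obtain c where c: "0 < c"
    "\<And>l. l \<in> Q \<Longrightarrow> norm (l - lb) \<le> c * norm (adjoint (D1 F xb) (l - lb))"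
    using strict_cq_estimate[OF D1_linear[OF F xb] cq] by blast
  define r where "r x = (\<Sum>e\<in>Basis. norm (D1 F xb e - D1 F x e))" for x
  have "(r \<longlongrightarrow> (\<Sum>e\<in>Basis. norm (D1 F xb e - D1 F xb e))) (nhds xb)"
    unfolding r_def by (intro tendsto_intros D1_tendsto[OF U F xb] filterlim_ident tendsto_const)
  then have "\<forall>\<^sub>F x in nhds xb. r x < 1 / (2 * c)"
    using c(1) by (intro order_tendstoD) auto
  moreover have "\<forall>\<^sub>F x in nhds xb. x \<in> U"
    using U xb by (rule eventually_nhds_in_open)
  ultimately have "\<forall>\<^sub>F x in nhds xb. \<forall>l\<in>Q. norm (l - lb) \<le> (2 * c) * norm (adjoint (D1 F x) (l - lb))"
  proof eventually_elim
    case (elim x)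
    show ?case
    proof
      fix l assume "l \<in> Q"
      let ?m = "l - lb"
      have "norm (adjoint (D1 F xb) ?m - adjoint (D1 F x) ?m) \<le>
          (\<Sum>e\<in>Basis. \<bar>(adjoint (D1 F xb) ?m - adjoint (D1 F x) ?m) \<bullet> e\<bar>)"
        by (rule norm_le_l1)
      also have "\<dots> = (\<Sum>e\<in>Basis. \<bar>(D1 F xb e - D1 F x e) \<bullet> ?m\<bar>)"
        by (simp add: inner_diff_left inner_diff_right adjoint_works[OF D1_linear[OF F xb]]
            adjoint_works[OF D1_linear[OF F \<open>x \<in> U\<close>]] inner_commute[of _ "_ :: 'a"] algebra_simps)
      also have "\<dots> \<le> (\<Sum>e\<in>Basis. norm (D1 F xb e - D1 F x e) * norm ?m)"
        by (intro sum_mono Cauchy_Schwarz_ineq2)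
      also have "\<dots> = r x * norm ?m"
        by (simp add: r_def sum_distrib_right)
      also have "\<dots> \<le> 1 / (2 * c) * norm ?m"
        using elim by (intro mult_right_mono) auto
      finally have "norm (adjoint (D1 F xb) ?m) \<le> norm (adjoint (D1 F x) ?m) + 1 / (2 * c) * norm ?m"
        by (smt (verit) norm_triangle_sub)
      then have "c * norm (adjoint (D1 F xb) ?m) \<le> c * norm (adjoint (D1 F x) ?m) + norm ?m / 2"
        using c(1) by (simp add: field_simps)
      then show "norm ?m \<le> (2 * c) * norm (adjoint (D1 F x) ?m)"
        using c(2)[OF \<open>l \<in> Q\<close>] by simp
    qed
  qed
  with that[of "2 * c"] c(1) show ?thesis
    by simp
qed

text \<open>The generators of the cone give a continuous, positively homogeneous right inverse
  \<open>y \<mapsto> (Up y, Np y)\<close> of \<open>(u, z) \<mapsto> A u - z\<close>; the correction of the straight line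
  is then a fixed point of minus the linearisation error.\<close>

lemma tangential_curve:
  fixes F :: "'a::euclidean_space \<Rightarrow> 'b::euclidean_space"
  assumes U: "open U" "xb \<in> U" and cont: "continuous_on U F" and "F xb = 0"
    and der: "(F has_derivative A) (at xb)"
    and zero: "0 \<in> N" and add: "\<And>x y. x \<in> N \<Longrightarrow> y \<in> N \<Longrightarrow> x + y \<in> N"
    and scale: "\<And>x c. x \<in> N \<Longrightarrow> 0 \<le> c \<Longrightarrow> c *\<^sub>R x \<in> N"
    and cq: "{A u - z | u z. z \<in> N} = UNIV"
    and h: "A h \<in> N" and "0 < e"
  obtains \<tau> where "0 < \<tau>"
    "\<And>t. 0 < t \<Longrightarrow> t < \<tau> \<Longrightarrow> \<exists>x\<in>U. F x \<in> N \<and> norm (x - xb - t *\<^sub>R h) \<le> e * t"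
proof -
  have A: "linear A"
    using der by (rule has_derivative_linear)
  have "\<exists>u z. y = A u - z \<and> z \<in> N" for y
    using cq by blast
  then obtain u z where uz: "\<And>y. y = A (u y) - z y" "\<And>y. z y \<in> N"
    by metis
  \<comment> \<open>Positive and negative parts of the coordinates give nonnegative coefficients,
    which keep \<open>Np y\<close> in the cone, and depend continuously on \<open>y\<close>, which
    the arbitrary choices \<open>u\<close> and \<open>z\<close> need not do.\<close>
  define Up where "Up y = (\<Sum>b\<in>Basis. max (y \<bullet> b) 0 *\<^sub>R u b + max (- (y \<bullet> b)) 0 *\<^sub>R u (- b))" for y
  define Np where "Np y = (\<Sum>b\<in>Basis. max (y \<bullet> b) 0 *\<^sub>R z b + max (- (y \<bullet> b)) 0 *\<^sub>R z (- b))" for y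
  have Np: "Np y \<in> N" for y
  proof -
    have sum: "sum g B \<in> N" if "finite B" "\<And>b. g b \<in> N" for g and B :: "'b set"
      using that by (induction B) (auto intro: zero add)
    show ?thesis
      unfolding Np_def by (intro sum add scale uz) auto
  qed
  have right_inv: "A (Up y) - Np y = y" for y
  proof -
    have "A (Up y) - Np y = (\<Sum>b\<in>Basis. max (y \<bullet> b) 0 *\<^sub>R (A (u b) - z b)
        + max (- (y \<bullet> b)) 0 *\<^sub>R (A (u (- b)) - z (- b)))"
      unfolding Up_def Np_def
      by (simp add: linear_sum[OF A] linear_add[OF A] linear_scale[OF A] algebra_simps
          flip: sum_subtractf)
    also have "\<dots> = (\<Sum>b\<in>Basis. (y \<bullet> b) *\<^sub>R b)"
      by (intro sum.cong) (auto simp: max_def simp flip: uz(1))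
    finally show ?thesis
      by (simp add: euclidean_representation)
  qed
  define \<kappa> where "\<kappa> = 1 + (\<Sum>b\<in>Basis. norm (u b) + norm (u (- b)))"
  have \<kappa>: "0 < \<kappa>"
    unfolding \<kappa>_def by (intro add_pos_nonneg sum_nonneg) auto
  have Up_le: "norm (Up y) \<le> \<kappa> * norm y" for y
  proof -
    have "norm (Up y) \<le> (\<Sum>b\<in>Basis. (norm (u b) + norm (u (- b))) * norm y)"
      unfolding Up_def
    proof (rule sum_norm_le)
      fix b :: 'b assume b: "b \<in> Basis"
      have "\<bar>y \<bullet> b\<bar> \<le> norm y"
        using b by (rule Basis_le_norm)
      then have "\<bar>max (y \<bullet> b) 0\<bar> \<le> norm y" "\<bar>max (- (y \<bullet> b)) 0\<bar> \<le> norm y"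
        by auto
      then have "norm (max (y \<bullet> b) 0 *\<^sub>R u b) \<le> norm y * norm (u b)"
        "norm (max (- (y \<bullet> b)) 0 *\<^sub>R u (- b)) \<le> norm y * norm (u (- b))"
        by (auto intro!: mult_right_mono)
      then show "norm (max (y \<bullet> b) 0 *\<^sub>R u b + max (- (y \<bullet> b)) 0 *\<^sub>R u (- b))
          \<le> (norm (u b) + norm (u (- b))) * norm y"
        using norm_triangle_ineq[of "max (y \<bullet> b) 0 *\<^sub>R u b" "max (- (y \<bullet> b)) 0 *\<^sub>R u (- b)"]
        by (simp add: algebra_simps)
    qed
    also have "\<dots> \<le> \<kappa> * norm y"
      unfolding \<kappa>_def by (simp add: distrib_right[of 1] flip: sum_distrib_right)
    finally show ?thesis .
  qed
  define H where "H = norm h + e"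
  have H: "0 < H"
    using \<open>0 < e\<close> by (simp add: H_def add_nonneg_pos)
  \<comment> \<open>All candidate points lie within \<open>H * t\<close> of \<open>xb\<close>. With
    this tolerance the linearisation error there is at most \<open>e * t / \<kappa>\<close>, the
    radius of the ball for Brouwer's theorem.\<close>
  define \<eta> where "\<eta> = e / (\<kappa> * H)"
  have "0 < \<eta>"
    using \<kappa> H \<open>0 < e\<close> by (simp add: \<eta>_def)
  then obtain d where d: "0 < d" "\<And>y. norm (y - xb) < d \<Longrightarrow> norm (F y - A (y - xb)) \<le> \<eta> * norm (y - xb)"
    using der \<open>F xb = 0\<close> unfolding has_derivative_at_alt by (metis diff_zero)
  obtain r where r: "0 < r" "ball xb r \<subseteq> U"
    using U open_contains_ball by blast
  define \<tau> where "\<tau> = min d r / H"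
  have "\<exists>x\<in>U. F x \<in> N \<and> norm (x - xb - t *\<^sub>R h) \<le> e * t" if t: "0 < t" "t < \<tau>" for t
  proof -
    define X where "X y = xb + t *\<^sub>R h + Up y" for y
    let ?B = "cball (0::'b) (e * t / \<kappa>)"
    have Up_small: "norm (Up y) \<le> e * t" if "y \<in> ?B" for y
      using Up_le[of y] that \<kappa> by (simp add: pos_le_divide_eq mult.commute)
    have X_le: "norm (X y - xb) \<le> H * t" if "y \<in> ?B" for y
      using norm_triangle_ineq[of "t *\<^sub>R h" "Up y"] Up_small[OF that] t
      by (simp add: X_def H_def algebra_simps)
    have Ht: "H * t < d" "H * t < r"
      using t H by (auto simp: \<tau>_def field_simps)
    have XU: "X y \<in> U" if "y \<in> ?B" for y
      using X_le[OF that] Ht r by (auto simp: dist_norm norm_minus_commute)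
    \<comment> \<open>At a fixed point, \<open>F (X y) = A (X y - xb) - y\<close>, and the right
      inverse reduces this to \<open>t *\<^sub>R A h + Np y\<close>, a sum of cone elements.\<close>
    define f where "f y = A (X y - xb) - F (X y)" for y
    have contX: "continuous_on ?B X"
      unfolding X_def Up_def by (intro continuous_intros)
    have "continuous_on ?B f"
      unfolding f_def using XU
      by (intro continuous_intros contX linear_continuous_on_compose[OF _ A]
          continuous_on_compose2[OF cont contX]) auto
    moreover have "f \<in> ?B \<rightarrow> ?B"
    proof
      fix y assume y: "y \<in> ?B"
      have "norm (F (X y) - A (X y - xb)) \<le> \<eta> * norm (X y - xb)"
        using X_le[OF y] Ht by (intro d(2)) simp
      also have "\<dots> \<le> \<eta> * (H * t)"
        using X_le[OF y] \<open>0 < \<eta>\<close> by (intro mult_left_mono) auto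
      also have "\<dots> = e * t / \<kappa>"
        using H \<kappa> by (simp add: \<eta>_def)
      finally show "f y \<in> ?B"
        by (simp add: f_def norm_minus_commute)
    qed
    moreover have "0 < e * t / \<kappa>"
      using \<open>0 < e\<close> t \<kappa> by simp
    ultimately obtain y where y: "y \<in> ?B" "f y = y"
      using brouwer_ball by blast
    have "A (X y - xb) = t *\<^sub>R A h + A (Up y)"
      by (simp add: X_def linear_add[OF A] linear_scale[OF A])
    then have "F (X y) = t *\<^sub>R A h + Np y"
      using y(2) right_inv[of y] by (simp add: f_def algebra_simps)
    then have "F (X y) \<in> N"
      using t h by (auto intro!: add scale Np)
    then show ?thesis
      using XU[OF y(1)] Up_small[OF y(1)] by (intro bexI[of _ "X y"]) (auto simp: X_def)
  qed
  moreover have "0 < \<tau>"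
    using d r H by (simp add: \<tau>_def)
  ultimately show ?thesis
    using that by blast
qed

section \<open>A chain rule for subgradients\<close>

text \<open>The Moreau envelope \<open>w \<mapsto> max {l \<bullet> w - a |l|\<^sup>2 | l \<in> Q}\<close> of the support function is
  attained at this projection.\<close>

lemma closest_point_maximizes:
  fixes Q :: "'b::euclidean_space set"
  assumes "closed Q" "l \<in> Q" "0 < a"
  shows "l \<bullet> w - a * (norm l)\<^sup>2 \<le>
    closest_point Q (w /\<^sub>R (2 * a)) \<bullet> w - a * (norm (closest_point Q (w /\<^sub>R (2 * a))))\<^sup>2"
proof -
  let ?p = "closest_point Q (w /\<^sub>R (2 * a))"
  have expand: "m \<bullet> w - a * (norm m)\<^sup>2 = (norm w)\<^sup>2 / (4 * a) - a * (norm (w /\<^sub>R (2 * a) - m))\<^sup>2" for m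
    using \<open>0 < a\<close>
    by (simp add: power2_norm_eq_inner inner_diff_left inner_diff_right inner_commute field_simps)
  have "norm (w /\<^sub>R (2 * a) - ?p) \<le> norm (w /\<^sub>R (2 * a) - l)"
    using closest_point_le[OF assms(1,2), of "w /\<^sub>R (2 * a)"] by (simp add: dist_norm)
  then have "(norm (w /\<^sub>R (2 * a) - ?p))\<^sup>2 \<le> (norm (w /\<^sub>R (2 * a) - l))\<^sup>2"
    by (rule power_mono) simp
  then show ?thesis
    unfolding expand using \<open>0 < a\<close> by simp
qed

text \<open>A Danskin argument. Using the maximiser \<open>p (Z t)\<close> at the old point
  \<open>y\<close> bounds the increment of the envelope by
  \<open>p (Z t) \<bullet> (F (Z t) - F y)\<close>, so that dividing by \<open>t\<close> needs only
  continuity of the projection.\<close>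

lemma envelope_stationary:
  fixes F :: "'a::euclidean_space \<Rightarrow> 'b::euclidean_space"
  assumes "convex Q" "closed Q" "Q \<noteq> {}" "0 < a" and W: "open W" "y \<in> W"
    and der: "(F has_derivative F') (at y)"
    and p: "\<And>z. p z = closest_point Q (F z /\<^sub>R (2 * a))"
    and min: "\<And>z. z \<in> W \<Longrightarrow>
      p y \<bullet> F y - a * (norm (p y))\<^sup>2 - v \<bullet> (y - x) + \<epsilon> * norm (y - x)
      \<le> p z \<bullet> F z - a * (norm (p z))\<^sup>2 - v \<bullet> (z - x) + \<epsilon> * norm (z - x)"
    and "0 \<le> \<epsilon>"
  shows "norm (adjoint F' (p y) - v) \<le> \<epsilon>"
proof -
  have F': "linear F'"
    using der by (rule has_derivative_linear)
  \<comment> \<open>Minimality is tested in the direction of the negative residual, where the linear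
    term is \<open>- (u \<bullet> u)\<close>.\<close>
  define u where "u = v - adjoint F' (p y)"
  define Z where "Z t = y + t *\<^sub>R u" for t :: real
  have pQ: "p z \<in> Q" for z
    unfolding p using assms by (intro closest_point_in_set)
  have Z0: "(Z \<longlongrightarrow> y) (at_right 0)"
  proof -
    have "(Z \<longlongrightarrow> y + 0 *\<^sub>R u) (at_right 0)"
      unfolding Z_def by (intro tendsto_intros)
    then show ?thesis by simp
  qed
  have derZ: "((\<lambda>t. (F (Z t) - F y) /\<^sub>R t) \<longlongrightarrow> F' u) (at_right 0)"
  proof -
    have "(Z has_derivative (\<lambda>t. t *\<^sub>R u)) (at 0)"
      unfolding Z_def by (auto intro!: derivative_eq_intros)
    moreover have "(F has_derivative F') (at (Z 0))"
      using der by (simp add: Z_def)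
    ultimately have "((\<lambda>t. F (Z t)) has_derivative (\<lambda>t. F' (t *\<^sub>R u))) (at 0)"
      by (rule has_derivative_compose)
    then have "((\<lambda>t. F (Z t)) has_derivative (\<lambda>t. F' (t *\<^sub>R u))) (at_right 0)"
      by (rule has_derivative_at_withinI)
    then have "((\<lambda>t. (1 / norm (t - 0)) *\<^sub>R (F (Z t) - (F (Z 0) + F' ((t - 0) *\<^sub>R u)))) \<longlongrightarrow> 0) (at_right 0)"
      unfolding has_derivative_within by blast
    then have "((\<lambda>t. (1 / norm (t - 0)) *\<^sub>R (F (Z t) - (F (Z 0) + F' ((t - 0) *\<^sub>R u))) + F' u) \<longlongrightarrow> 0 + F' u)
        (at_right 0)"
      by (intro tendsto_intros)
    moreover have "\<forall>\<^sub>F t in at_right 0. (1 / norm (t - 0)) *\<^sub>R (F (Z t) - (F (Z 0) + F' ((t - 0) *\<^sub>R u))) + F' u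
        = (F (Z t) - F y) /\<^sub>R t"
      using eventually_at_right_less[of 0]
      by eventually_elim
        (simp add: Z_def linear_scale[OF F'] scaleR_diff_right scaleR_add_right divide_inverse)
    ultimately show ?thesis
      by (simp add: Lim_transform_eventually)
  qed
  have pZ: "((\<lambda>t. p (Z t)) \<longlongrightarrow> p y) (at_right 0)"
  proof -
    have "((\<lambda>t. F (Z t)) \<longlongrightarrow> F y) (at_right 0)"
      using der Z0 by (intro isCont_tendsto_compose[of y F]) (auto dest: has_derivative_continuous)
    then have "((\<lambda>t. F (Z t) /\<^sub>R (2 * a)) \<longlongrightarrow> F y /\<^sub>R (2 * a)) (at_right 0)"
      by (intro tendsto_intros)
    then show ?thesis
      unfolding p using continuous_at_closest_point assms
      by (intro isCont_tendsto_compose[of _ "closest_point Q"]) auto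
  qed
  have "\<forall>\<^sub>F t in at_right 0. Z t \<in> W"
    using Z0 W by (rule topological_tendstoD)
  with eventually_at_right_less[of 0]
  have "\<forall>\<^sub>F t in at_right 0. 0 \<le> p (Z t) \<bullet> ((F (Z t) - F y) /\<^sub>R t) - v \<bullet> u + \<epsilon> * norm u"
  proof eventually_elim
    case (elim t)
    have "p (Z t) \<bullet> F y - a * (norm (p (Z t)))\<^sup>2 \<le> p y \<bullet> F y - a * (norm (p y))\<^sup>2"
      unfolding p[of y] using assms pQ by (intro closest_point_maximizes)
    moreover have "norm (Z t - x) \<le> norm (y - x) + t * norm u"
      using norm_triangle_ineq[of "y - x" "t *\<^sub>R u"] elim by (simp add: Z_def algebra_simps)
    then have "\<epsilon> * norm (Z t - x) \<le> \<epsilon> * norm (y - x) + t * (\<epsilon> * norm u)"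
      using \<open>0 \<le> \<epsilon>\<close> by (metis distrib_left mult.left_commute mult_left_mono)
    moreover have "v \<bullet> (Z t - x) = v \<bullet> (y - x) + t * (v \<bullet> u)"
      by (simp add: Z_def inner_add_right inner_diff_right)
    ultimately have "0 \<le> p (Z t) \<bullet> (F (Z t) - F y) - t * (v \<bullet> u) + t * (\<epsilon> * norm u)"
      using min[OF \<open>Z t \<in> W\<close>] by (simp add: inner_diff_right)
    then have "0 \<le> (p (Z t) \<bullet> (F (Z t) - F y) - t * (v \<bullet> u) + t * (\<epsilon> * norm u)) / t"
      using elim by simp
    also have "\<dots> = p (Z t) \<bullet> ((F (Z t) - F y) /\<^sub>R t) - v \<bullet> u + \<epsilon> * norm u"
      using elim by (simp only: inner_scaleR_right) (simp add: field_simps)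
    finally show ?case .
  qed
  moreover have "((\<lambda>t. p (Z t) \<bullet> ((F (Z t) - F y) /\<^sub>R t) - v \<bullet> u + \<epsilon> * norm u) \<longlongrightarrow>
      p y \<bullet> F' u - v \<bullet> u + \<epsilon> * norm u) (at_right 0)"
    by (intro tendsto_intros pZ derZ)
  ultimately have "0 \<le> p y \<bullet> F' u - v \<bullet> u + \<epsilon> * norm u"
    by (intro tendsto_lowerbound[of _ _ "at_right 0" 0]) auto
  also have "p y \<bullet> F' u = adjoint F' (p y) \<bullet> u"
    by (metis adjoint_works[OF F'] inner_commute)
  finally have "u \<bullet> u \<le> \<epsilon> * norm u"
    unfolding u_def inner_diff_left by linarith
  then have "norm u * norm u \<le> \<epsilon> * norm u"
    by (simp flip: dot_square_norm power2_eq_square)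
  then have "norm u \<le> \<epsilon>"
    using \<open>0 \<le> \<epsilon>\<close> by (metis mult_right_le_imp_le norm_ge_zero order_le_less)
  then show ?thesis
    by (simp add: u_def norm_minus_commute)
qed

text \<open>A finite subset of \<open>Q\<close> suffices to keep the support function above the lower bound given by
  \<open>v\<close> on a whole ball; so does the envelope for small \<open>a\<close>. On the boundary sphere it then exceeds
  its value at \<open>x\<close>, which forces an interior minimiser.\<close>

lemma fuzzy_chain_rule:
  fixes F :: "'a::euclidean_space \<Rightarrow> 'b::euclidean_space"
  assumes Q: "convex Q" "closed Q" "Q \<noteq> {}" and U: "open U" "x \<in> U"
    and der: "\<And>y. y \<in> U \<Longrightarrow> (F has_derivative F' y) (at y)"
    and f: "\<And>y. y \<in> U \<Longrightarrow> f y = ereal c + support_fun Q (F y)" and fx: "f x = ereal b"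
    and v: "v \<in> regular_subdiff f x" and "0 < \<epsilon>"
  shows "\<exists>y\<in>U. \<exists>l\<in>Q. norm (y - x) < \<epsilon> \<and> norm (adjoint (F' y) l - v) \<le> \<epsilon> \<and> b - c - \<epsilon> \<le> l \<bullet> F y"
proof -
  have contF: "continuous_on U F"
    using der has_derivative_continuous by (blast intro: continuous_at_imp_continuous_on)
  have "0 \<le> Liminf (at x) (\<lambda>y. (f y - f x - ereal (v \<bullet> (y - x))) / ereal (norm (y - x)))"
    using v by (auto simp: regular_subdiff_def)
  then have "\<forall>\<^sub>F y in at x. ereal (- \<epsilon> / 2) < (f y - f x - ereal (v \<bullet> (y - x))) / ereal (norm (y - x))"
    using \<open>0 < \<epsilon>\<close> unfolding le_Liminf_iff by (auto simp: zero_ereal_def)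
  then obtain r1 where r1: "0 < r1"
    "\<And>y. y \<noteq> x \<Longrightarrow> dist y x < r1 \<Longrightarrow>
      ereal (- \<epsilon> / 2) < (f y - f x - ereal (v \<bullet> (y - x))) / ereal (norm (y - x))"
    unfolding eventually_at by blast
  obtain r2 where r2: "0 < r2" "cball x r2 \<subseteq> U"
    using U open_contains_cball by blast
  \<comment> \<open>The last entry ensures
    \<open>r * (norm v + \<epsilon>) \<le> \<epsilon>\<close>, which is the total loss allowed in
    the final value bound.\<close>
  define r where "r = min (min (r1 / 2) r2) (min (\<epsilon> / 2) (\<epsilon> / (norm v + \<epsilon>)))"
  have r: "0 < r" "r < r1" "r \<le> r2" "r < \<epsilon>" "r * (norm v + \<epsilon>) \<le> \<epsilon>"
  proof -
    have "0 < norm v + \<epsilon>"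
      using \<open>0 < \<epsilon>\<close> by (simp add: add_nonneg_pos)
    then show "0 < r"
      using r1 r2 \<open>0 < \<epsilon>\<close> by (simp add: r_def)
    show "r < r1" "r \<le> r2" "r < \<epsilon>"
    proof -
      have "r \<le> r1 / 2" "r \<le> r2" "r \<le> \<epsilon> / 2"
        unfolding r_def by linarith+
      then show "r < r1" "r \<le> r2" "r < \<epsilon>"
        using r1(1) \<open>0 < \<epsilon>\<close> by linarith+
    qed
    have "r \<le> \<epsilon> / (norm v + \<epsilon>)"
      by (simp add: r_def)
    then show "r * (norm v + \<epsilon>) \<le> \<epsilon>"
      using \<open>0 < norm v + \<epsilon>\<close> by (simp add: pos_le_divide_eq)
  qed
  let ?C = "cball x r"
  have CU: "?C \<subseteq> U"
    using r r2 by auto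
  have f_lower: "ereal (b + v \<bullet> (y - x) - \<epsilon> / 2 * norm (y - x)) \<le> f y" if "y \<in> ?C" for y
  proof (cases "y = x")
    case True
    then show ?thesis
      by (simp add: fx)
  next
    case False
    then have "ereal (- \<epsilon> / 2) < (f y - ereal b - ereal (v \<bullet> (y - x))) / ereal (norm (y - x))"
      using r1(2)[of y] that r by (simp add: fx dist_commute)
    then show ?thesis
      using False by (cases "f y") (auto simp: field_simps)
  qed
  \<comment> \<open>This is lost twice: in \<open>\<theta>\<close> and in the quadratic term of the
    envelope. On the sphere the loss \<open>2 * \<eta>\<close> plus the slope loss
    \<open>\<epsilon> / 2 * r\<close> is exactly the penalty \<open>\<epsilon> * r\<close>.\<close>
  define \<eta> where "\<eta> = \<epsilon> * r / 4"
  have "0 < \<eta>"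
    using \<open>0 < \<epsilon>\<close> r by (simp add: \<eta>_def)
  define \<theta> where "\<theta> y = b - c + v \<bullet> (y - x) - \<epsilon> / 2 * norm (y - x) - \<eta>" for y
  have ex: "\<exists>l\<in>Q. \<theta> y < l \<bullet> F y" if "y \<in> ?C" for y
  proof -
    have "y \<in> U"
      using that CU by blast
    have "ereal (\<theta> y) < support_fun Q (F y)"
      using f_lower[OF that] \<open>0 < \<eta>\<close> unfolding f[OF \<open>y \<in> U\<close>]
      by (cases "support_fun Q (F y)") (auto simp: \<theta>_def)
    then show ?thesis
      unfolding support_fun_def less_SUP_iff by simp
  qed
  have contG: "continuous_on ?C F"
    using contF CU by (rule continuous_on_subset)
  have "\<exists>L\<subseteq>Q. finite L \<and> ?C \<subseteq> (\<Union>l\<in>L. {y \<in> U. 0 < l \<bullet> F y - \<theta> y})"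
  proof (rule compactE_image[OF compact_cball, of Q "\<lambda>l. {y \<in> U. 0 < l \<bullet> F y - \<theta> y}" x r])
    show "open {y \<in> U. 0 < l \<bullet> F y - \<theta> y}" for l
    proof -
      have "continuous_on U (\<lambda>y. l \<bullet> F y - \<theta> y)"
        unfolding \<theta>_def by (intro continuous_intros contF)
      then have "open (U \<inter> (\<lambda>y. l \<bullet> F y - \<theta> y) -` {0<..})"
        using U(1) by (simp add: continuous_open_preimage)
      then show ?thesis
        by (simp add: Collect_conj_eq vimage_def)
    qed
    show "?C \<subseteq> (\<Union>l\<in>Q. {y \<in> U. 0 < l \<bullet> F y - \<theta> y})"
    proof
      fix y assume "y \<in> ?C"
      then show "y \<in> (\<Union>l\<in>Q. {y \<in> U. 0 < l \<bullet> F y - \<theta> y})"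
        using ex[of y] subsetD[OF CU] by auto
    qed
  qed blast
  then obtain L where L: "L \<subseteq> Q" "finite L" and cover: "?C \<subseteq> (\<Union>l\<in>L. {y \<in> U. 0 < l \<bullet> F y - \<theta> y})"
    by blast
  have L_ex: "\<exists>l\<in>L. \<theta> y < l \<bullet> F y" if "y \<in> ?C" for y
    using subsetD[OF cover that] by auto
  \<comment> \<open>Small enough that the quadratic term costs at most \<open>\<eta>\<close> at each
    of the finitely many \<open>l \<in> L\<close>; the summand 1 keeps the denominator
    positive.\<close>
  define a where "a = \<eta> / (1 + (\<Sum>l\<in>L. (norm l)\<^sup>2))"
  have pos: "0 < 1 + (\<Sum>l\<in>L. (norm l)\<^sup>2)"
    by (intro add_pos_nonneg sum_nonneg) auto
  then have "0 < a"
    using \<open>0 < \<eta>\<close> by (simp add: a_def)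
  have a_le: "a * (norm l)\<^sup>2 \<le> \<eta>" if "l \<in> L" for l
  proof -
    have "(norm l)\<^sup>2 \<le> (\<Sum>l\<in>L. (norm l)\<^sup>2)"
      using L(2) that by (intro member_le_sum) auto
    then have "a * (norm l)\<^sup>2 \<le> a * (1 + (\<Sum>l\<in>L. (norm l)\<^sup>2))"
      using \<open>0 < a\<close> by (intro mult_left_mono) auto
    then show ?thesis
      using pos by (simp add: a_def)
  qed
  define p where "p z = closest_point Q (F z /\<^sub>R (2 * a))" for z
  have pQ: "p z \<in> Q" for z
    unfolding p_def using Q by (intro closest_point_in_set)
  define \<sigma> where "\<sigma> z = p z \<bullet> F z - a * (norm (p z))\<^sup>2" for z
  have \<sigma>: "\<theta> y - \<eta> < \<sigma> y" if "y \<in> ?C" for y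
  proof -
    from L_ex[OF that] obtain l where l: "l \<in> L" "\<theta> y < l \<bullet> F y"
      by blast
    have "l \<bullet> F y - a * (norm l)\<^sup>2 \<le> \<sigma> y"
      unfolding \<sigma>_def p_def using Q L l \<open>0 < a\<close> by (intro closest_point_maximizes) auto
    then show ?thesis
      using a_le[OF l(1)] l(2) by simp
  qed
  define g where "g y = \<sigma> y - v \<bullet> (y - x) + \<epsilon> * norm (y - x)" for y
  have "continuous_on ?C p"
    unfolding p_def
    by (intro continuous_on_compose2[OF continuous_on_closest_point[OF Q, of UNIV]]
        continuous_intros contG) auto
  then have "continuous_on ?C g"
    unfolding g_def \<sigma>_def by (intro continuous_intros contG)
  then obtain y where y: "y \<in> ?C" and min: "\<And>z. z \<in> ?C \<Longrightarrow> g y \<le> g z"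
    using continuous_attains_inf[of ?C g] r(1) by auto
  have "g x \<le> b - c"
  proof -
    have "ereal (p x \<bullet> F x) \<le> support_fun Q (F x)"
      using pQ by (rule support_fun_ge)
    then have "p x \<bullet> F x \<le> b - c"
      using f[OF U(2)] fx by (cases "support_fun Q (F x)") auto
    moreover have "0 \<le> a * (norm (p x))\<^sup>2"
      using \<open>0 < a\<close> by simp
    ultimately show ?thesis
      by (simp add: g_def \<sigma>_def)
  qed
  then have gy: "g y \<le> b - c"
    using min[of x] r(1) by simp
  have "norm (y - x) < r"
  proof (rule ccontr)
    assume "\<not> norm (y - x) < r"
    then have "norm (y - x) = r"
      using y by (simp add: dist_norm norm_minus_commute)
    then show False
      using gy \<sigma>[OF y] by (simp add: g_def \<theta>_def \<eta>_def)
  qed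
  have "norm (adjoint (F' y) (p y) - v) \<le> \<epsilon>"
  proof (rule envelope_stationary[OF Q \<open>0 < a\<close> open_ball[of x r] _ der p_def])
    show "y \<in> ball x r" "0 \<le> \<epsilon>"
      using \<open>norm (y - x) < r\<close> \<open>0 < \<epsilon>\<close> by (auto simp: dist_norm norm_minus_commute)
    show "y \<in> U"
      using y CU by blast
    show "p y \<bullet> F y - a * (norm (p y))\<^sup>2 - v \<bullet> (y - x) + \<epsilon> * norm (y - x)
      \<le> p z \<bullet> F z - a * (norm (p z))\<^sup>2 - v \<bullet> (z - x) + \<epsilon> * norm (z - x)" if "z \<in> ball x r" for z
      using min[of z] that by (simp add: g_def \<sigma>_def)
  qed
  moreover have "b - c - \<epsilon> \<le> p y \<bullet> F y"
  proof -
    have "norm v * norm (y - x) \<le> norm v * r" "\<epsilon> * norm (y - x) \<le> \<epsilon> * r"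
      using \<open>norm (y - x) < r\<close> \<open>0 < \<epsilon>\<close> by (auto intro!: mult_left_mono)
    moreover have "- (norm v * norm (y - x)) \<le> v \<bullet> (y - x)"
      using Cauchy_Schwarz_ineq2[of v "y - x"] by linarith
    moreover have "\<sigma> y \<le> p y \<bullet> F y"
      using \<open>0 < a\<close> by (simp add: \<sigma>_def)
    ultimately show ?thesis
      using \<sigma>[OF y] r(5) unfolding \<theta>_def \<eta>_def by (simp add: algebra_simps)
  qed
  ultimately show ?thesis
    using y CU pQ \<open>norm (y - x) < r\<close> r(4) by (intro bexI[of _ y] bexI[of _ "p y"]) auto
qed

section \<open>The strict second subderivative\<close>

lemma Ck_on_subset: "Ck_on k F U \<Longrightarrow> V \<subseteq> U \<Longrightarrow> Ck_on k F V"
  by (induction k arbitrary: F) (auto intro: continuous_on_subset)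

text \<open>The neighborhood is taken small enough for the multiplier estimate to hold at each of
  its points, and the value at \<open>xb\<close> is recorded as a real number
  \<open>c0\<close>.\<close>

locale strict_decomposition =
  fixes f :: "'a::euclidean_space \<Rightarrow> ereal" and F :: "'a \<Rightarrow> 'b::euclidean_space"
    and Q :: "'b set" and xb :: 'a and lb :: 'b and U :: "'a set" and c0 c :: real
  assumes U: "open U" and xb: "xb \<in> U" and F: "Ck_on 2 F U" and Fxb: "F xb = 0"
    and Q: "convex Q" "closed Q" and lb: "lb \<in> Q"
    and cq: "{D1 F xb u - z | u z. z \<in> normal_cone Q lb} = UNIV"
    and f: "\<And>x. x \<in> U \<Longrightarrow> f x = ereal c0 + support_fun Q (F x)"
    and estimate: "\<And>x l. x \<in> U \<Longrightarrow> l \<in> Q \<Longrightarrow> norm (l - lb) \<le> c * norm (adjoint (D1 F x) (l - lb))"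
    and c: "0 < c"
begin

section \<open>Subgradients and their multipliers\<close>

lemma f_normal_cone:
  assumes "x \<in> U" "F x \<in> normal_cone Q l"
  shows "f x = ereal (c0 + l \<bullet> F x)"
  using f[OF assms(1)] support_fun_normal_cone[OF assms(2)] by simp

lemma adjoint_D1_diff:
  "x \<in> U \<Longrightarrow> adjoint (D1 F x) (l - m) = adjoint (D1 F x) l - adjoint (D1 F x) m"
  by (rule linear_diff, rule adjoint_linear, rule D1_linear[OF F])

text \<open>Near \<open>x\<close> the function majorises \<open>c0 + l \<bullet> F y\<close>, with
  equality at \<open>x\<close>. The gradient of this smooth minorant is thus a regular subgradient,
  and constant sequences make it a limiting one.\<close>

lemma multiplier_in_subdiff:
  assumes x: "x \<in> U" and N: "F x \<in> normal_cone Q l"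
  shows "adjoint (D1 F x) l \<in> subdiff f x"
proof -
  have l: "l \<in> Q"
    using N by (auto simp: normal_cone_def split: if_splits)
  let ?v = "adjoint (D1 F x) l"
  let ?q = "\<lambda>y. (f y - f x - ereal (?v \<bullet> (y - x))) / ereal (norm (y - x))"
  have fx: "f x = ereal (c0 + l \<bullet> F x)"
    using assms by (rule f_normal_cone)
  have "0 \<le> Liminf (at x) ?q"
    unfolding le_Liminf_iff
  proof (intro allI impI)
    fix b :: ereal assume "b < 0"
    then obtain e where e: "0 < e" "b < ereal (- e)"
    proof -
      obtain r where "b < ereal r" "ereal r < 0"
        using \<open>b < 0\<close> by (metis ereal_dense2 zero_ereal_def)
      then show thesis
        using that[of "- r"] by (simp add: zero_ereal_def)
    qed
    define e' where "e' = e / (1 + norm l)"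
    have "0 < 1 + norm l"
      by (simp add: add_pos_nonneg)
    then have e': "0 < e'" "norm l * e' \<le> e"
      using e by (auto simp: e'_def field_simps)
    have "\<forall>\<^sub>F y in at x. norm (F y - F x - D1 F x (y - x)) \<le> e' * norm (y - x)"
      using D1_has_derivative[OF F x] e'(1) unfolding has_derivative_within_alt2 by blast
    moreover have "\<forall>\<^sub>F y in at x. y \<in> U"
      using U x by (rule eventually_at_in_open')
    ultimately show "\<forall>\<^sub>F y in at x. b < ?q y"
      using eventually_neq_at_within[of x]
    proof eventually_elim
      case (elim y)
      have "- (l \<bullet> (F y - F x - D1 F x (y - x))) \<le> norm l * (e' * norm (y - x))"
        using Cauchy_Schwarz_ineq2[of l "F y - F x - D1 F x (y - x)"] elim(1)
        by (smt (verit) mult_left_mono norm_ge_zero)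
      also have "\<dots> \<le> e * norm (y - x)"
        using mult_right_mono[OF e'(2), of "norm (y - x)"] by (simp add: mult.assoc)
      finally have lin: "- e * norm (y - x) \<le> l \<bullet> F y - l \<bullet> F x - ?v \<bullet> (y - x)"
        using adjoint_works[OF D1_linear[OF F x], of "y - x" l]
        by (simp add: inner_diff_right inner_commute)
      have "ereal (- e * norm (y - x)) \<le> f y - f x - ereal (?v \<bullet> (y - x))"
        using support_fun_ge[OF l, of "F y"] lin unfolding fx f[OF \<open>y \<in> U\<close>]
        by (cases "support_fun Q (F y)") auto
      then have "ereal (- e) \<le> ?q y"
        using elim(3) by (simp add: ereal_le_divide_pos mult.commute)
      with e(2) show ?case
        by (rule less_le_trans)
    qed
  qed
  then have "?v \<in> regular_subdiff f x"
    by (simp add: regular_subdiff_def fx)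
  then have "(\<lambda>_. x) \<longlonglongrightarrow> x \<and> (\<lambda>_. f x) \<longlonglongrightarrow> f x \<and> (\<forall>k::nat. ?v \<in> regular_subdiff f x) \<and> (\<lambda>_. ?v) \<longlonglongrightarrow> ?v"
    by simp
  then show ?thesis
    unfolding subdiff_def mem_Collect_eq by (intro conjI exI) (auto simp: fx)
qed

text \<open>The fuzzy chain rule supplies approximate multipliers for the regular subgradients that
  define \<open>v\<close>. The multiplier estimate bounds them, and the limit of a subsequence is an
  exact multiplier.\<close>

lemma subdiff_multiplier:
  assumes x: "x \<in> U" and v: "v \<in> subdiff f x"
  shows "\<exists>l. F x \<in> normal_cone Q l \<and> adjoint (D1 F x) l = v"
proof -
  obtain X V where fin: "\<bar>f x\<bar> \<noteq> \<infinity>" and X: "X \<longlonglongrightarrow> x" "(\<lambda>k. f (X k)) \<longlonglongrightarrow> f x"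
    and V: "\<And>k. V k \<in> regular_subdiff f (X k)" "V \<longlonglongrightarrow> v"
    using v by (auto simp: subdiff_def)
  obtain N where "\<And>k. k \<ge> N \<Longrightarrow> X k \<in> U"
    using topological_tendstoD[OF X(1) U x] by (auto simp: eventually_sequentially)
  then have XU: "X (k + N) \<in> U" for k
    by simp
  have fX: "f (X k) = ereal (real_of_ereal (f (X k)))" for k
    using V(1)[of k] by (auto simp: regular_subdiff_def ereal_real')
  have "\<exists>y\<in>U. \<exists>l\<in>Q. norm (y - X (k + N)) < inverse (Suc k) \<and>
      norm (adjoint (D1 F y) l - V (k + N)) \<le> inverse (Suc k) \<and>
      real_of_ereal (f (X (k + N))) - c0 - inverse (Suc k) \<le> l \<bullet> F y" for k
    using Q lb by (intro fuzzy_chain_rule[OF Q _ U XU _ f fX V(1)] D1_has_derivative[OF F]) auto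
  then obtain Y L where Y: "\<And>k. Y k \<in> U" "\<And>k. norm (Y k - X (k + N)) < inverse (Suc k)"
    and L: "\<And>k. L k \<in> Q" "\<And>k. norm (adjoint (D1 F (Y k)) (L k) - V (k + N)) \<le> inverse (Suc k)"
    and LF: "\<And>k. real_of_ereal (f (X (k + N))) - c0 - inverse (Suc k) \<le> L k \<bullet> F (Y k)"
    by metis
  have "(\<lambda>k. Y k - X (k + N)) \<longlonglongrightarrow> 0"
    by (rule Lim_null_comparison[OF _ LIMSEQ_inverse_real_of_nat]) (intro always_eventually allI less_imp_le Y(2))
  from tendsto_add[OF this LIMSEQ_ignore_initial_segment[OF X(1), of N]]
  have Yx: "Y \<longlonglongrightarrow> x"
    by simp
  have "(\<lambda>k. adjoint (D1 F (Y k)) (L k) - V (k + N)) \<longlonglongrightarrow> 0"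
    by (rule Lim_null_comparison[OF _ LIMSEQ_inverse_real_of_nat]) (intro always_eventually allI L(2))
  from tendsto_add[OF this LIMSEQ_ignore_initial_segment[OF V(2), of N]]
  have adj: "(\<lambda>k. adjoint (D1 F (Y k)) (L k)) \<longlonglongrightarrow> v"
    by simp
  have "(\<lambda>k. adjoint (D1 F (Y k)) (L k) - adjoint (D1 F (Y k)) lb) \<longlonglongrightarrow> v - adjoint (D1 F x) lb"
    by (intro tendsto_intros adj adjoint_D1_tendsto[OF U F x] Yx)
  \<comment> \<open>Convergence of the adjoint images becomes boundedness of the multipliers through
    \<open>estimate\<close>.\<close>
  then have "Bseq (\<lambda>k. adjoint (D1 F (Y k)) (L k - lb))"
    using Y(1) by (simp add: adjoint_D1_diff convergentI convergent_imp_Bseq)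
  then obtain K where K: "\<And>k. norm (adjoint (D1 F (Y k)) (L k - lb)) \<le> K"
    unfolding Bseq_def by blast
  have "norm (L k) \<le> norm lb + c * K" for k
  proof -
    have "norm (L k - lb) \<le> c * K"
      using order_trans[OF estimate[OF Y(1) L(1)] mult_left_mono[OF K]] c by simp
    then show ?thesis
      using norm_triangle_sub[of "L k" lb] by simp
  qed
  then have "bounded (range L)"
    unfolding bounded_iff by blast
  then obtain l \<rho> where \<rho>: "strict_mono \<rho>" and l: "(L \<circ> \<rho>) \<longlonglongrightarrow> l"
    using bounded_imp_convergent_subsequence by blast
  have "l \<in> Q"
    using closed_sequentially[OF Q(2) _ l] L(1) by simp
  have Y\<rho>: "(Y \<circ> \<rho>) \<longlonglongrightarrow> x"
    using Yx \<rho> by (rule LIMSEQ_subseq_LIMSEQ)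
  have "(\<lambda>k. adjoint (D1 F ((Y \<circ> \<rho>) k)) ((L \<circ> \<rho>) k)) \<longlonglongrightarrow> adjoint (D1 F x) l"
    by (intro adjoint_D1_tendsto[OF U F x] Y\<rho> l)
  moreover have "(\<lambda>k. adjoint (D1 F ((Y \<circ> \<rho>) k)) ((L \<circ> \<rho>) k)) \<longlonglongrightarrow> v"
    using LIMSEQ_subseq_LIMSEQ[OF adj \<rho>] by (simp add: o_def)
  ultimately have "adjoint (D1 F x) l = v"
    by (rule LIMSEQ_unique)
  moreover have "F x \<in> normal_cone Q l"
  proof (rule normal_cone_support_fun[OF \<open>l \<in> Q\<close>])
    \<comment> \<open>Convergence of function values, part of the limiting subdifferential, is what
      forces the limit \<open>l\<close> to be exposed by \<open>F x\<close>.\<close>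
    have "(\<lambda>k. real_of_ereal (f (X k))) \<longlonglongrightarrow> real_of_ereal (f x)"
      using fin X(2) by (intro lim_real_of_ereal) (simp add: ereal_real')
    then have "(\<lambda>k. real_of_ereal (f (X (k + N)))) \<longlonglongrightarrow> real_of_ereal (f x)"
      by (rule LIMSEQ_ignore_initial_segment)
    then have "(\<lambda>k. real_of_ereal (f (X (k + N))) - c0 - inverse (Suc k)) \<longlonglongrightarrow> real_of_ereal (f x) - c0 - 0"
      by (intro tendsto_diff tendsto_const LIMSEQ_inverse_real_of_nat)
    from LIMSEQ_subseq_LIMSEQ[OF this \<rho>]
    have "(\<lambda>k. real_of_ereal (f (X (\<rho> k + N))) - c0 - inverse (Suc (\<rho> k))) \<longlonglongrightarrow> real_of_ereal (f x) - c0"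
      by (simp add: o_def)
    moreover have "(\<lambda>k. (L \<circ> \<rho>) k \<bullet> F ((Y \<circ> \<rho>) k)) \<longlonglongrightarrow> l \<bullet> F x"
      by (intro tendsto_intros F_tendsto[OF U F x] Y\<rho> l)
    ultimately have "real_of_ereal (f x) - c0 \<le> l \<bullet> F x"
      by (rule LIMSEQ_le) (use LF in auto)
    then show "support_fun Q (F x) \<le> ereal (l \<bullet> F x)"
      using fin f[OF x] by (cases "support_fun Q (F x)") auto
  qed
  ultimately show ?thesis
    by blast
qed

text \<open>Any \<open>l' \<in> Q\<close> minorises the support function at the far point. Inside
  the hull \<open>l' = l\<close> is used, outside it a point on a tangent path from
  \<open>l\<close>.\<close>

lemma second_diff_quot_ge:
  assumes "0 < t" and x: "x \<in> U" "x + t *\<^sub>R h \<in> U" and N: "F x \<in> normal_cone Q l" and l': "l' \<in> Q"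
  shows "ereal (2 / t\<^sup>2 * (l' \<bullet> F (x + t *\<^sub>R h) - l \<bullet> F x - t * (l \<bullet> D1 F x h)))
    \<le> second_diff_quot f t x (adjoint (D1 F x) l) h"
proof -
  have adj: "adjoint (D1 F x) l \<bullet> h = l \<bullet> D1 F x h"
    using adjoint_works[OF D1_linear[OF F x(1)], of h l] by (simp add: inner_commute)
  let ?s = "l' \<bullet> F (x + t *\<^sub>R h) - l \<bullet> F x - t * (l \<bullet> D1 F x h)"
  have "ereal ?s \<le> f (x + t *\<^sub>R h) - f x - ereal (t * (l \<bullet> D1 F x h))"
    using support_fun_ge[OF l', of "F (x + t *\<^sub>R h)"] unfolding f_normal_cone[OF x(1) N] f[OF x(2)]
    by (cases "support_fun Q (F (x + t *\<^sub>R h))") auto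
  moreover have "ereal (2 / t\<^sup>2 * ?s) = ereal ?s / ereal (t\<^sup>2 / 2)"
    using \<open>0 < t\<close> by simp
  ultimately show ?thesis
    unfolding second_diff_quot_def adj using \<open>0 < t\<close>
    by (simp only: ereal_divide_right_mono[of _ _ "ereal (t\<^sup>2 / 2)"] ereal_less(2) zero_less_power half_gt_zero)
qed

lemma second_diff_quot_normal_cone:
  assumes "0 < t" and x: "x \<in> U" "x + t *\<^sub>R h \<in> U"
    and N: "F x \<in> normal_cone Q l" "F (x + t *\<^sub>R h) \<in> normal_cone Q l"
  shows "second_diff_quot f t x (adjoint (D1 F x) l) h =
    ereal (l \<bullet> ((2 / t\<^sup>2) *\<^sub>R (F (x + t *\<^sub>R h) - F x - t *\<^sub>R D1 F x h)))"
proof -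
  have "adjoint (D1 F x) l \<bullet> h = l \<bullet> D1 F x h"
    using adjoint_works[OF D1_linear[OF F x(1)], of h l] by (simp add: inner_commute)
  then have "second_diff_quot f t x (adjoint (D1 F x) l) h =
      ereal ((l \<bullet> (F (x + t *\<^sub>R h) - F x - t *\<^sub>R D1 F x h)) / (t\<^sup>2 / 2))"
    using \<open>0 < t\<close> unfolding second_diff_quot_def f_normal_cone[OF x(1) N(1)] f_normal_cone[OF x(2) N(2)]
    by (simp add: inner_diff_right)
  then show ?thesis
    by simp
qed

text \<open>The adjoint at \<open>L i - lb\<close> equals
  \<open>V i - adjoint (D1 F (X i)) lb\<close>, which tends to 0; \<open>estimate\<close> transfers
  this to \<open>L i - lb\<close>.\<close>

lemma multipliers_tendsto:
  assumes X: "(X \<longlongrightarrow> xb) G" and V: "(V \<longlongrightarrow> adjoint (D1 F xb) lb) G"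
    and sub: "\<forall>\<^sub>F i in G. V i \<in> subdiff f (X i)"
  obtains L where "\<forall>\<^sub>F i in G. F (X i) \<in> normal_cone Q (L i) \<and> adjoint (D1 F (X i)) (L i) = V i"
    and "\<forall>\<^sub>F i in G. L i \<in> Q" and "(L \<longlongrightarrow> lb) G"
proof -
  define L where "L i = (SOME l. F (X i) \<in> normal_cone Q l \<and> adjoint (D1 F (X i)) l = V i)" for i
  have XU: "\<forall>\<^sub>F i in G. X i \<in> U"
    using eventually_in_U[OF U F xb X] .
  have L: "\<forall>\<^sub>F i in G. F (X i) \<in> normal_cone Q (L i) \<and> adjoint (D1 F (X i)) (L i) = V i"
    using XU sub
  proof eventually_elim
    case (elim i)
    show ?case
      unfolding L_def by (rule someI_ex, rule subdiff_multiplier) (use elim in auto)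
  qed
  then have LQ: "\<forall>\<^sub>F i in G. L i \<in> Q"
    by eventually_elim (auto simp: normal_cone_def split: if_splits)
  have "((\<lambda>i. c * norm (V i - adjoint (D1 F (X i)) lb)) \<longlongrightarrow>
      c * norm (adjoint (D1 F xb) lb - adjoint (D1 F xb) lb)) G"
    by (intro tendsto_intros V adjoint_D1_tendsto[OF U F xb X])
  then have "((\<lambda>i. c * norm (V i - adjoint (D1 F (X i)) lb)) \<longlongrightarrow> 0) G"
    by simp
  moreover have "\<forall>\<^sub>F i in G. norm (L i - lb) \<le> c * norm (V i - adjoint (D1 F (X i)) lb)"
    using L LQ XU by eventually_elim (metis adjoint_D1_diff estimate)
  ultimately have "((\<lambda>i. L i - lb) \<longlongrightarrow> 0) G"
    by (rule Lim_null_comparison[rotated])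
  then have "(L \<longlongrightarrow> lb) G"
    by (simp add: LIM_zero_iff)
  with L LQ that show thesis
    by blast
qed

section \<open>Lower bounds for the quotients along an arbitrary filter\<close>

context
  fixes G :: "'i filter" and T :: "'i \<Rightarrow> real" and X V H :: "'i \<Rightarrow> 'a" and h
  assumes T: "(T \<longlongrightarrow> 0) G" "\<forall>\<^sub>F i in G. 0 < T i" and H: "(H \<longlongrightarrow> h) G"
    and X: "(X \<longlongrightarrow> xb) G" and V: "(V \<longlongrightarrow> adjoint (D1 F xb) lb) G"
    and sub: "\<forall>\<^sub>F i in G. V i \<in> subdiff f (X i)"
begin

lemma XTH_tendsto: "((\<lambda>i. X i + T i *\<^sub>R H i) \<longlongrightarrow> xb) G"
proof -
  have "((\<lambda>i. X i + T i *\<^sub>R H i) \<longlongrightarrow> xb + 0 *\<^sub>R h) G"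
    by (intro tendsto_intros X T H)
  then show ?thesis by simp
qed

lemma eventually_second_diff_quot_gt:
  assumes "B < lb \<bullet> D2 F xb h h"
  shows "\<forall>\<^sub>F i in G. ereal B < second_diff_quot f (T i) (X i) (V i) (H i)"
proof -
  obtain L where L: "\<forall>\<^sub>F i in G. F (X i) \<in> normal_cone Q (L i) \<and> adjoint (D1 F (X i)) (L i) = V i"
    and LQ: "\<forall>\<^sub>F i in G. L i \<in> Q" and Llb: "(L \<longlongrightarrow> lb) G"
    using multipliers_tendsto[OF X V sub] by blast
  let ?q = "\<lambda>i. (2 / (T i)\<^sup>2) *\<^sub>R (F (X i + T i *\<^sub>R H i) - F (X i) - T i *\<^sub>R D1 F (X i) (H i))"
  have "((\<lambda>i. L i \<bullet> ?q i) \<longlongrightarrow> lb \<bullet> D2 F xb h h) G"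
    by (intro tendsto_inner Llb Taylor_quotient_tendsto[OF U F xb T X H])
  then have "\<forall>\<^sub>F i in G. B < L i \<bullet> ?q i"
    using assms by (rule order_tendstoD)
  with L LQ eventually_in_U[OF U F xb X] eventually_in_U[OF U F xb XTH_tendsto] T(2)
  show ?thesis
  proof eventually_elim
    case (elim i)
    have "ereal (L i \<bullet> ?q i) \<le> second_diff_quot f (T i) (X i) (V i) (H i)"
      using second_diff_quot_ge[of "T i" "X i" "H i" "L i" "L i"] elim
      by (simp add: inner_diff_right)
    with elim(6) show ?case
      by (meson ereal_less(2) less_ereal.simps(1) less_le_trans)
  qed
qed

text \<open>Relative to \<open>t\<^sup>2\<close>, the first-order path term contributes at a fixed
  order, since its direction is orthogonal to \<open>F (X i)\<close> and \<open>F\<close> changes by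
  order \<open>t\<close>. The second-order remainder is bounded and multiplies values of
  \<open>F\<close> that tend to \<open>F xb = 0\<close>.\<close>

lemma eventually_second_diff_quot_gt_outside:
  assumes UTP: "UTP_at Q lb" and h: "D1 F xb h \<notin> span (normal_cone Q lb)"
  shows "\<forall>\<^sub>F i in G. ereal B < second_diff_quot f (T i) (X i) (V i) (H i)"
proof -
  obtain w where w: "w \<in> lineality (tangent_cone Q lb)" "norm w = 1" "0 < w \<bullet> D1 F xb h"
    using exists_lineality_not_in_span_normal_cone[OF Q(1) lb h] .
  let ?\<Q> = "inf (nhds lb) (principal Q)"
  obtain \<delta> M W S where \<delta>: "0 < \<delta>" and W: "open W" "lb \<in> W"
    and S: "\<And>l. l \<in> Q \<Longrightarrow> l \<in> W \<Longrightarrow> subspace (S l) \<and> S l \<subseteq> lineality (tangent_cone Q l)"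
    and conv: "PK_converges S (lineality (tangent_cone Q lb)) ?\<Q>"
    and path: "\<forall>l\<in>Q \<inter> W. \<forall>v\<in>S l. norm v = 1 \<longrightarrow> (\<exists>\<xi> r. continuous_on {0..\<delta>} \<xi> \<and>
      (\<forall>t\<in>{0..\<delta>}. \<xi> t \<in> Q \<and> \<xi> t = l + t *\<^sub>R v + (t\<^sup>2 / 2) *\<^sub>R r t \<and> norm (r t) \<le> M))"
    using UTP unfolding UTP_at_def by (elim conjE exE) blast
  have path: "\<exists>r. l + t *\<^sub>R v + (t\<^sup>2 / 2) *\<^sub>R r \<in> Q \<and> norm r \<le> M"
    if "l \<in> Q" "l \<in> W" "v \<in> S l" "norm v = 1" "0 \<le> t" "t \<le> \<delta>" for l v and t :: real
    using path that by (metis IntI atLeastAtMost_iff)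
  \<comment> \<open>Projecting \<open>w\<close> onto \<open>S l\<close> selects directions that tend
    to \<open>w\<close>, because \<open>w\<close> lies in the inner limit of the subspaces.\<close>
  define \<omega> where "\<omega> l = closest_point (S l) w" for l
  have evQ: "\<forall>\<^sub>F l in ?\<Q>. l \<in> Q \<and> l \<in> W"
    using W by (auto simp: eventually_inf_principal eventually_nhds)
  have \<omega>: "(\<omega> \<longlongrightarrow> w) ?\<Q>"
  proof (rule tendstoI)
    fix e :: real assume "0 < e"
    have "w \<in> inner_limit ?\<Q> S"
      using w conv by (simp add: PK_converges_def)
    then have "\<forall>\<^sub>F l in ?\<Q>. S l \<inter> ball w e \<noteq> {}"
      using \<open>0 < e\<close> unfolding inner_limit_def by simp
    with evQ show "\<forall>\<^sub>F l in ?\<Q>. dist (\<omega> l) w < e"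
    proof eventually_elim
      case (elim l)
      then obtain s where "s \<in> S l" "dist w s < e"
        by auto
      moreover have "closed (S l)"
        using S elim by (intro closed_subspace) auto
      ultimately show ?case
        using closest_point_le[of "S l" s w] by (simp add: \<omega>_def dist_commute)
    qed
  qed
  obtain L where L: "\<forall>\<^sub>F i in G. F (X i) \<in> normal_cone Q (L i) \<and> adjoint (D1 F (X i)) (L i) = V i"
    and LQ: "\<forall>\<^sub>F i in G. L i \<in> Q" and Llb: "(L \<longlongrightarrow> lb) G"
    using multipliers_tendsto[OF X V sub] by blast
  have "filterlim L ?\<Q> G"
    using Llb LQ by (simp add: filterlim_inf filterlim_principal)
  then have \<omega>L: "((\<lambda>i. \<omega> (L i)) \<longlongrightarrow> w) G"
    by (rule filterlim_compose[OF \<omega>])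
  \<comment> \<open>Paths are available for unit directions only; as \<open>w\<close> has norm 1,
    normalising keeps the limit.\<close>
  define s where "s i = sgn (\<omega> (L i))" for i
  have "w \<noteq> 0"
    using w by auto
  then have "(s \<longlongrightarrow> sgn w) G"
    unfolding s_def by (intro tendsto_sgn \<omega>L)
  then have sw: "(s \<longlongrightarrow> w) G"
    using w by (simp add: sgn_div_norm)
  have ev\<omega>: "\<forall>\<^sub>F i in G. \<omega> (L i) \<noteq> 0"
    using \<omega>L \<open>w \<noteq> 0\<close> by (rule tendsto_imp_eventually_ne)
  let ?q = "\<lambda>i. (2 / (T i)\<^sup>2) *\<^sub>R (F (X i + T i *\<^sub>R H i) - F (X i) - T i *\<^sub>R D1 F (X i) (H i))"
  let ?d = "\<lambda>i. (F (X i + T i *\<^sub>R H i) - F (X i)) /\<^sub>R T i"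
  \<comment> \<open>Chosen so that \<open>C * (w \<bullet> D1 F xb h)\<close> exceeds the gap
    between \<open>B\<close> and the curvature term by 1.\<close>
  define C where "C = (\<bar>B - lb \<bullet> D2 F xb h h\<bar> + 1) / (w \<bullet> D1 F xb h)"
  have "0 < C"
    using w by (simp add: C_def)
  \<comment> \<open>The lower bound from testing at path parameter \<open>C * T i\<close>: the
    remainder \<open>(C * T i)\<^sup>2 / 2\<close> times \<open>r\<close>, divided by
    \<open>(T i)\<^sup>2 / 2\<close>, leaves the factor \<open>C\<^sup>2\<close>.\<close>
  define \<psi> where "\<psi> i = L i \<bullet> ?q i + 2 * C * (s i \<bullet> ?d i) - C\<^sup>2 * M * norm (F (X i + T i *\<^sub>R H i))" for i
  have "(\<psi> \<longlongrightarrow> lb \<bullet> D2 F xb h h + 2 * C * (w \<bullet> D1 F xb h) - C\<^sup>2 * M * norm (F xb)) G"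
    unfolding \<psi>_def
    by (intro tendsto_intros Llb sw Taylor_quotient_tendsto[OF U F xb T X H]
        difference_quotient_tendsto[OF U F xb T X H] F_tendsto[OF U F xb] XTH_tendsto)
  moreover have "C * (w \<bullet> D1 F xb h) = \<bar>B - lb \<bullet> D2 F xb h h\<bar> + 1"
    using w by (simp add: C_def)
  then have "B < lb \<bullet> D2 F xb h h + 2 * C * (w \<bullet> D1 F xb h) - C\<^sup>2 * M * norm (F xb)"
    using Fxb by simp
  ultimately have "\<forall>\<^sub>F i in G. B < \<psi> i"
    by (rule order_tendstoD)
  moreover have "((\<lambda>i. C * T i) \<longlongrightarrow> C * 0) G"
    by (intro tendsto_intros T)
  then have "\<forall>\<^sub>F i in G. C * T i < \<delta>"
    using \<delta> by (intro order_tendstoD) auto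
  moreover have "\<forall>\<^sub>F i in G. L i \<in> W"
    using Llb W by (rule topological_tendstoD)
  ultimately show ?thesis
    using ev\<omega> L LQ eventually_in_U[OF U F xb X] eventually_in_U[OF U F xb XTH_tendsto] T(2)
  proof eventually_elim
    case (elim i)
    let ?t = "T i" and ?Fx = "F (X i)" and ?Fy = "F (X i + T i *\<^sub>R H i)"
    have subS: "subspace (S (L i))" "S (L i) \<subseteq> lineality (tangent_cone Q (L i))"
      using S elim by auto
    then have "\<omega> (L i) \<in> S (L i)"
      unfolding \<omega>_def by (intro closest_point_in_set closed_subspace) (auto dest: subspace_0)
    then have sS: "s i \<in> S (L i)"
      using subS(1) by (simp add: s_def sgn_div_norm subspace_scale)
    have "norm (s i) = 1"
      using elim by (simp add: s_def norm_sgn)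
    then obtain r where r: "L i + (C * ?t) *\<^sub>R s i + ((C * ?t)\<^sup>2 / 2) *\<^sub>R r \<in> Q" "norm r \<le> M"
      using path[OF _ _ sS, of "C * ?t"] elim \<open>0 < C\<close> by auto
    have orth: "s i \<bullet> ?Fx = 0"
      using lineality_tangent_normal_orthogonal sS subS(2) elim by blast
    have rM: "- (M * norm ?Fy) \<le> r \<bullet> ?Fy"
      using Cauchy_Schwarz_ineq2[of r ?Fy] mult_right_mono[OF r(2), of "norm ?Fy"] by simp
    let ?l = "L i + (C * ?t) *\<^sub>R s i + ((C * ?t)\<^sup>2 / 2) *\<^sub>R r"
    have lq: "L i \<bullet> ?q i = 2 / ?t\<^sup>2 * (L i \<bullet> ?Fy - L i \<bullet> ?Fx - ?t * (L i \<bullet> D1 F (X i) (H i)))"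
      by (simp only: inner_scaleR_right inner_diff_right)
    have sd: "s i \<bullet> ?d i = (s i \<bullet> ?Fy) / ?t"
      by (simp only: inner_scaleR_right inner_diff_right orth) (simp add: field_simps)
    have "2 / ?t\<^sup>2 * (?l \<bullet> ?Fy - L i \<bullet> ?Fx - ?t * (L i \<bullet> D1 F (X i) (H i)))
        = L i \<bullet> ?q i + 2 * C * (s i \<bullet> ?d i) + C\<^sup>2 * (r \<bullet> ?Fy)"
      using \<open>0 < ?t\<close> unfolding lq sd
      by (simp add: inner_add_left power_mult_distrib power2_eq_square field_simps)
    also have "\<dots> \<ge> \<psi> i"
      using mult_left_mono[OF rM, of "C\<^sup>2"] by (simp add: \<psi>_def)
    finally have "B < 2 / ?t\<^sup>2 * (?l \<bullet> ?Fy - L i \<bullet> ?Fx - ?t * (L i \<bullet> D1 F (X i) (H i)))"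
      using elim(1) by simp
    moreover have "ereal (2 / ?t\<^sup>2 * (?l \<bullet> ?Fy - L i \<bullet> ?Fx - ?t * (L i \<bullet> D1 F (X i) (H i))))
        \<le> second_diff_quot f ?t (X i) (V i) (H i)"
      using second_diff_quot_ge[OF _ _ _ _ r(1), of ?t "X i" "H i" "L i"] elim by simp
    ultimately show ?case
      by (meson less_ereal.simps(1) less_le_trans)
  qed
qed

end

section \<open>The upper bound, by a recovery sequence\<close>

lemma strict_second_subderiv_le:
  assumes h: "D1 F xb h1 \<in> normal_cone Q lb" "D1 F xb h2 \<in> normal_cone Q lb"
  shows "strict_second_subderiv f xb (adjoint (D1 F xb) lb) (h1 - h2)
    \<le> ereal (lb \<bullet> D2 F xb (h1 - h2) (h1 - h2))"
proof -
  let ?N = "normal_cone Q lb" and ?h = "h1 - h2"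
  have contF: "continuous_on U F"
    using D1_has_derivative[OF F] has_derivative_continuous
    by (blast intro: continuous_at_imp_continuous_on)
  have "\<exists>t x y. 0 < t \<and> t \<le> inverse (Suc k) \<and> x \<in> U \<and> y \<in> U \<and> F x \<in> ?N \<and> F y \<in> ?N \<and>
      norm (y - xb - t *\<^sub>R h1) \<le> inverse (Suc k) * t \<and>
      norm (x - xb - t *\<^sub>R h2) \<le> inverse (Suc k) * t" for k
  proof -
    have curve: "\<exists>\<tau>>0. \<forall>t. 0 < t \<and> t < \<tau> \<longrightarrow>
        (\<exists>x\<in>U. F x \<in> ?N \<and> norm (x - xb - t *\<^sub>R h') \<le> inverse (Suc k) * t)"
      if "D1 F xb h' \<in> ?N" for h'
      by (rule tangential_curve[OF U xb contF Fxb D1_has_derivative[OF F xb]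
            zero_mem_normal_cone[OF lb] normal_cone_add normal_cone_scale cq that, of "inverse (Suc k)"])
        auto
    obtain \<tau>1 where \<tau>1: "0 < \<tau>1" "\<And>t. 0 < t \<Longrightarrow> t < \<tau>1 \<Longrightarrow>
        \<exists>x\<in>U. F x \<in> ?N \<and> norm (x - xb - t *\<^sub>R h1) \<le> inverse (Suc k) * t"
      using curve[OF h(1)] by blast
    obtain \<tau>2 where \<tau>2: "0 < \<tau>2" "\<And>t. 0 < t \<Longrightarrow> t < \<tau>2 \<Longrightarrow>
        \<exists>x\<in>U. F x \<in> ?N \<and> norm (x - xb - t *\<^sub>R h2) \<le> inverse (Suc k) * t"
      using curve[OF h(2)] by blast
    \<comment> \<open>A common parameter for both curves; halving makes it strictly smaller than
      each bound, and the cap sends it to 0 with \<open>k\<close>.\<close>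
    define t where "t = min (min \<tau>1 \<tau>2 / 2) (inverse (Suc k))"
    have "0 < t" "t < \<tau>1" "t < \<tau>2" "t \<le> inverse (Suc k)"
      using \<tau>1(1) \<tau>2(1) by (auto simp: t_def min_less_iff_disj)
    with \<tau>1(2)[of t] \<tau>2(2)[of t] show ?thesis
      by blast
  qed
  then obtain T X Y where T: "\<And>k. 0 < T k" "\<And>k. T k \<le> inverse (Suc k)"
    and XY: "\<And>k. X k \<in> U" "\<And>k. Y k \<in> U" "\<And>k. F (X k) \<in> ?N" "\<And>k. F (Y k) \<in> ?N"
    and Y: "\<And>k. norm (Y k - xb - T k *\<^sub>R h1) \<le> inverse (Suc k) * T k"
    and X: "\<And>k. norm (X k - xb - T k *\<^sub>R h2) \<le> inverse (Suc k) * T k"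
    by metis
  have T0: "T \<longlonglongrightarrow> 0"
    by (rule Lim_null_comparison[OF _ LIMSEQ_inverse_real_of_nat])
      (use T in \<open>simp add: abs_of_pos\<close>)
  have dir: "(\<lambda>k. (Z k - xb) /\<^sub>R T k) \<longlonglongrightarrow> h'"
    if Z: "\<And>k. norm (Z k - xb - T k *\<^sub>R h') \<le> inverse (Suc k) * T k" for Z h'
  proof -
    have "norm ((Z k - xb) /\<^sub>R T k - h') \<le> inverse (Suc k)" for k
    proof -
      have "(Z k - xb) /\<^sub>R T k - h' = (Z k - xb - T k *\<^sub>R h') /\<^sub>R T k"
        using T(1)[of k] by (simp add: scaleR_diff_right)
      then have "norm ((Z k - xb) /\<^sub>R T k - h') = norm (Z k - xb - T k *\<^sub>R h') / T k"
        using T(1)[of k] by (simp add: divide_inverse mult.commute)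
      then show ?thesis
        using Z[of k] T(1)[of k] by (simp add: pos_divide_le_eq)
    qed
    then have "(\<lambda>k. (Z k - xb) /\<^sub>R T k - h') \<longlonglongrightarrow> 0"
      by (intro Lim_null_comparison[OF _ LIMSEQ_inverse_real_of_nat]) simp
    then show ?thesis
      by (simp add: LIM_zero_iff)
  qed
  \<comment> \<open>This difference of the two curve directions makes the step from
    \<open>X k\<close> end exactly at \<open>Y k\<close>, where \<open>F\<close> again lies in the
    normal cone.\<close>
  define H where "H k = (Y k - xb) /\<^sub>R T k - (X k - xb) /\<^sub>R T k" for k
  have H: "H \<longlonglongrightarrow> ?h"
    unfolding H_def by (intro tendsto_diff dir X Y)
  have XTH: "X k + T k *\<^sub>R H k = Y k" for k
    using T(1)[of k] by (simp add: H_def scaleR_diff_right)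
  have "(\<lambda>k. xb + T k *\<^sub>R ((X k - xb) /\<^sub>R T k)) \<longlonglongrightarrow> xb + 0 *\<^sub>R h2"
    by (intro tendsto_intros T0 dir X)
  moreover have "xb + T k *\<^sub>R ((X k - xb) /\<^sub>R T k) = X k" for k
    using T(1)[of k] by simp
  ultimately have Xlim: "X \<longlonglongrightarrow> xb"
    by simp
  define V where "V k = adjoint (D1 F (X k)) lb" for k
  have Vlim: "V \<longlonglongrightarrow> adjoint (D1 F xb) lb"
    unfolding V_def by (intro adjoint_D1_tendsto[OF U F xb] Xlim tendsto_const)
  have "(\<lambda>k. c0 + lb \<bullet> F (X k)) \<longlonglongrightarrow> c0 + lb \<bullet> F xb"
    by (intro tendsto_intros F_tendsto[OF U F xb] Xlim)
  moreover have "f xb = ereal (c0 + lb \<bullet> F xb)"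
    by (rule f_normal_cone[OF xb]) (simp add: Fxb zero_mem_normal_cone lb)
  ultimately have flim: "(\<lambda>k. f (X k)) \<longlonglongrightarrow> f xb"
    by (simp add: f_normal_cone[OF XY(1,3)])
  let ?G = "at_right (0::real) \<times>\<^sub>F nhds ?h \<times>\<^sub>F attentive_graph_filter f xb (adjoint (D1 F xb) lb)"
  have "filterlim (\<lambda>k. (X k, V k)) (attentive_graph_filter f xb (adjoint (D1 F xb) lb)) sequentially"
    unfolding attentive_graph_filter_def filterlim_inf filterlim_principal filterlim_filtercomap_iff
    using tendsto_Pair[OF Xlim Vlim] multiplier_in_subdiff[OF XY(1,3)] flim
    by (simp add: o_def V_def)
  then have lim: "filterlim (\<lambda>k. (T k, H k, X k, V k)) ?G sequentially"
    by (intro filterlim_Pair H tendsto_imp_filterlim_at_right T0 always_eventually allI T)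
  have "(\<lambda>k. lb \<bullet> ((2 / (T k)\<^sup>2) *\<^sub>R (F (X k + T k *\<^sub>R H k) - F (X k) - T k *\<^sub>R D1 F (X k) (H k))))
      \<longlonglongrightarrow> lb \<bullet> D2 F xb ?h ?h"
    by (intro tendsto_inner tendsto_const Taylor_quotient_tendsto[OF U F xb T0 _ Xlim H]) (simp add: T)
  then have quot: "(\<lambda>k. second_diff_quot f (T k) (X k) (V k) (H k)) \<longlonglongrightarrow> ereal (lb \<bullet> D2 F xb ?h ?h)"
    unfolding V_def by (simp add: second_diff_quot_normal_cone XTH T XY)
  show ?thesis
  \<comment> \<open>A value strictly between the limit along the sequence and the lower limit would
    eventually be both exceeded and not reached by the quotients.\<close>
  proof (rule ccontr)
    assume "\<not> ?thesis"
    then obtain b where b: "ereal (lb \<bullet> D2 F xb ?h ?h) < b"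
      "b < Liminf ?G (\<lambda>(t, h', x, v). second_diff_quot f t x v h')"
      unfolding strict_second_subderiv_def not_le by (blast dest: dense)
    from filterlim_iff[THEN iffD1, OF lim, rule_format, OF less_LiminfD[OF b(2)]]
    have "\<forall>\<^sub>F k in sequentially. b < second_diff_quot f (T k) (X k) (V k) (H k)"
      by simp
    moreover have "\<forall>\<^sub>F k in sequentially. second_diff_quot f (T k) (X k) (V k) (H k) < b"
      using quot b(1) by (rule order_tendstoD)
    ultimately have "\<forall>\<^sub>F k in sequentially. False"
      by eventually_elim simp
    then show False
      by simp
  qed
qed

text \<open>The coordinate projections of the product filter satisfy the hypotheses on
  \<open>T\<close>, \<open>H\<close>, \<open>X\<close> and \<open>V\<close>, so the filter-based
  lower bounds apply directly.\<close>

lemma strict_second_subderiv_eq: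
  assumes UTP: "UTP_at Q lb"
  shows "strict_second_subderiv f xb (adjoint (D1 F xb) lb) h =
    ereal (lb \<bullet> D2 F xb h h) + cvx_indicator (affine hull (D1 F xb -` normal_cone Q lb)) h"
proof -
  let ?G = "at_right (0::real) \<times>\<^sub>F nhds h \<times>\<^sub>F attentive_graph_filter f xb (adjoint (D1 F xb) lb)"
  let ?N = "normal_cone Q lb"
  note aff = affine_hull_vimage_normal_cone[OF D1_linear[OF F xb] lb cq]
  define T where "T = (fst :: real \<times> 'a \<times> 'a \<times> 'a \<Rightarrow> real)"
  define H where "H p = fst (snd p)" for p :: "real \<times> 'a \<times> 'a \<times> 'a"
  define X where "X p = fst (snd (snd p))" for p :: "real \<times> 'a \<times> 'a \<times> 'a"
  define V where "V p = snd (snd (snd p))" for p :: "real \<times> 'a \<times> 'a \<times> 'a"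
  have "filterlim T (at_right 0) ?G"
    unfolding T_def by (rule filterlim_fst)
  then have T: "(T \<longlongrightarrow> 0) ?G" "\<forall>\<^sub>F p in ?G. 0 < T p"
    by (auto simp: filterlim_at elim: eventually_mono)
  have H: "(H \<longlongrightarrow> h) ?G"
    unfolding H_def by (rule filterlim_compose[OF filterlim_fst filterlim_snd])
  have XV: "filterlim (\<lambda>p. snd (snd p)) (attentive_graph_filter f xb (adjoint (D1 F xb) lb)) ?G"
    by (rule filterlim_compose[OF filterlim_snd filterlim_snd])
  then have lim: "((\<lambda>p. snd (snd p)) \<longlongrightarrow> (xb, adjoint (D1 F xb) lb)) ?G"
    and sub: "\<forall>\<^sub>F p in ?G. V p \<in> subdiff f (X p)"
    unfolding attentive_graph_filter_def filterlim_inf filterlim_principal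
    by (auto simp: X_def V_def case_prod_beta)
  have X: "(X \<longlongrightarrow> xb) ?G" and V: "(V \<longlongrightarrow> adjoint (D1 F xb) lb) ?G"
    unfolding X_def V_def using tendsto_fst[OF lim] tendsto_snd[OF lim] by simp_all
  note gt = eventually_second_diff_quot_gt[OF T H X V sub]
    eventually_second_diff_quot_gt_outside[OF T H X V sub UTP]
  have quot: "(\<lambda>(t, h', x, v). second_diff_quot f t x v h') =
      (\<lambda>p. second_diff_quot f (T p) (X p) (V p) (H p))"
    by (auto simp: T_def H_def X_def V_def)
  \<comment> \<open>Real bounds \<open>B\<close> suffice since reals are dense among extended reals;
    taking \<open>C = \<infinity>\<close> covers the case outside the hull.\<close>
  have ge: "C \<le> strict_second_subderiv f xb (adjoint (D1 F xb) lb) h"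
    if "\<And>B. ereal B < C \<Longrightarrow> \<forall>\<^sub>F p in ?G. ereal B < second_diff_quot f (T p) (X p) (V p) (H p)" for C
    unfolding strict_second_subderiv_def quot le_Liminf_iff
  proof (intro allI impI)
    fix y assume "y < C"
    then obtain B where "y < ereal B" "ereal B < C"
      using ereal_dense2 by blast
    with that[OF this(2)] show "\<forall>\<^sub>F p in ?G. y < second_diff_quot f (T p) (X p) (V p) (H p)"
      by (auto elim!: eventually_mono intro: less_trans)
  qed
  show ?thesis
  proof (cases "h \<in> affine hull (D1 F xb -` ?N)")
    case True
    then obtain h1 h2 where h: "h = h1 - h2" "D1 F xb h1 \<in> ?N" "D1 F xb h2 \<in> ?N"
      unfolding aff(2) by blast
    have "strict_second_subderiv f xb (adjoint (D1 F xb) lb) h \<le> ereal (lb \<bullet> D2 F xb h h)"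
      using strict_second_subderiv_le[OF h(2,3)] by (simp add: h(1))
    moreover have "ereal (lb \<bullet> D2 F xb h h) \<le> strict_second_subderiv f xb (adjoint (D1 F xb) lb) h"
      by (intro ge gt) simp
    ultimately show ?thesis
      using True by (simp add: cvx_indicator_def)
  next
    case False
    then have "D1 F xb h \<notin> span ?N"
      unfolding aff(1) by simp
    then have "\<infinity> \<le> strict_second_subderiv f xb (adjoint (D1 F xb) lb) h"
      by (intro ge gt)
    then show ?thesis
      using False by (simp add: cvx_indicator_def)
  qed
qed

end

theorem theorem3p20:
  fixes \<phi> :: "real ^ 'n \<Rightarrow> ereal"
    and F :: "real ^ 'n \<Rightarrow> real ^ 'm"
    and Q :: "(real ^ 'm) set"
    and xb :: "real ^ 'n" and lb :: "real ^ 'm"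
  assumes "proper \<phi>"
    and "lower_semicontinuous \<phi>"
    and "C2_strictly_u_decomposable_at \<phi> xb Q F lb"
  shows "\<forall>h. strict_second_subderiv \<phi> xb (adjoint (D1 F xb) lb) h =
           ereal (lb \<bullet> D2 F xb h h) +
           cvx_indicator (affine hull (D1 F xb -` normal_cone Q lb)) h"
proof
  fix h
  obtain U where Q: "closed Q" "convex Q" "lb \<in> Q" and U: "open U" "xb \<in> U" "Ck_on 2 F U"
    and \<phi>: "\<And>x. x \<in> U \<Longrightarrow> \<phi> x = \<phi> xb + support_fun Q (F x)" and "F xb = 0" and "\<phi> xb < \<infinity>"
    and cq: "{D1 F xb u - z | u z. z \<in> normal_cone Q lb} = UNIV" and UTP: "UTP_at Q lb"
    using assms(3)
    unfolding C2_strictly_u_decomposable_at_def strictly_decomposable_at_def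
      decomposable_at_def eff_dom_def mem_Collect_eq
    by (elim conjE exE) metis
  obtain c where c: "0 < c"
    and "\<forall>\<^sub>F x in nhds xb. \<forall>l\<in>Q. norm (l - lb) \<le> c * norm (adjoint (D1 F x) (l - lb))"
    using multiplier_estimate[OF U(1,3,2) cq] by blast
  then obtain W where W: "open W" "xb \<in> W"
    "\<And>x l. x \<in> W \<Longrightarrow> l \<in> Q \<Longrightarrow> norm (l - lb) \<le> c * norm (adjoint (D1 F x) (l - lb))"
    unfolding eventually_nhds by blast
  obtain c0 where "\<phi> xb = ereal c0"
    using \<open>\<phi> xb < \<infinity>\<close> assms(1) by (cases "\<phi> xb") (auto simp: proper_def)
  then have "\<phi> x = ereal c0 + support_fun Q (F x)" if "x \<in> U" for x
    using \<phi>[OF that] by simp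
  \<comment> \<open>Intersecting with \<open>W\<close> gives a neighborhood on which the
    decomposition and the multiplier estimate hold together.\<close>
  then interpret strict_decomposition \<phi> F Q xb lb "U \<inter> W" c0 c
    using U W Q \<open>F xb = 0\<close> cq c Ck_on_subset[OF U(3), of "U \<inter> W"]
    by unfold_locales auto
  show "strict_second_subderiv \<phi> xb (adjoint (D1 F xb) lb) h =
      ereal (lb \<bullet> D2 F xb h h) + cvx_indicator (affine hull (D1 F xb -` normal_cone Q lb)) h"
    using UTP by (rule strict_second_subderiv_eq)
qed

end
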